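(* Let $0<\alpha<1$ be a real number and let $D\geq 2$ be an integer. Then, up to isomorphism, there are only finitely many coconnected non-bipartite distance-regular graphs $\Gamma$ with valency $k\geq 2$ and diameter $D$ whose smallest eigenvalue $\theta_{\min}$ satisfies $\theta_{\min}\leq -\alpha k$.
   Context: All graphs are finite, undirected and simple. A connected graph $\Gamma$ of diameter $D$ is distance-regular if there are integers $b_i,c_i$ ($0\le i\le D$) such that for any two vertices $x,y$ at distance $i$, $y$ has exactly $c_i$ neighbours at distance $i-1$ from $x$ and exactly $b_i$ neighbours at distance $i+1$ from $x$; its valency is $k=b_0$. The eigenvalues of $\Gamma$ are those of its adjacency matrix. A graph is coconnected if its complement is connected. *)

theory Defs
  imports
    "Graph_Theory.Pair_Digraph"
    "Graph_Theory.Digraph_Isomorphism"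
    "Jordan_Normal_Form.Spectral_Radius"
begin

text \<open>
  A finite undirected simple graph is a \<^locale>\<open>pair_graph\<close>: a finite vertex set together with a
  finite, symmetric and irreflexive set of arcs, each edge being a pair of opposite arcs.
  The qualified name below distinguishes graph connectedness (which includes that there is at
  least one vertex) from the topological notion.
\<close>

definition graph_connected :: "'a pair_pre_digraph \<Rightarrow> bool" where
  "graph_connected G \<longleftrightarrow> Digraph_Component.connected (with_proj G)"

definition graph_complement :: "'a pair_pre_digraph \<Rightarrow> 'a pair_pre_digraph" where
  "graph_complement G = \<lparr> pverts = pverts G,
     parcs = {(u, v). u \<in> pverts G \<and> v \<in> pverts G \<and> u \<noteq> v \<and> (u, v) \<notin> parcs G} \<rparr>"

definition coconnected :: "'a pair_pre_digraph \<Rightarrow> bool" where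
  "coconnected G \<longleftrightarrow> graph_connected (graph_complement G)"

definition bipartite :: "'a pair_pre_digraph \<Rightarrow> bool" where
  "bipartite G \<longleftrightarrow> (\<exists>A B. A \<union> B = pverts G \<and> A \<inter> B = {} \<and> parcs G \<subseteq> A \<times> B \<union> B \<times> A)"

text \<open>The distance is only meaningful when \<open>v\<close> is reachable from \<open>u\<close>, so the notions built on
  it are used for connected graphs only.\<close>

definition graph_dist :: "'a pair_pre_digraph \<Rightarrow> 'a \<Rightarrow> 'a \<Rightarrow> nat" where
  "graph_dist G u v = (LEAST n. \<exists>p. pre_digraph.awalk (with_proj G) u p v \<and> length p = n)"

definition graph_diameter :: "'a pair_pre_digraph \<Rightarrow> nat" where
  "graph_diameter G = Max {graph_dist G u v | u v. u \<in> pverts G \<and> v \<in> pverts G}"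

text \<open>Distance \<open>i - 1\<close> is written as \<open>graph_dist G x z + 1 = i\<close> to avoid truncated subtraction
  at \<open>i = 0\<close>; thus \<open>c 0 = 0\<close>. The values \<open>b i\<close> and \<open>c i\<close> beyond the diameter are irrelevant.\<close>

definition intersection_numbers ::
  "'a pair_pre_digraph \<Rightarrow> (nat \<Rightarrow> nat) \<Rightarrow> (nat \<Rightarrow> nat) \<Rightarrow> bool" where
  "intersection_numbers G b c \<longleftrightarrow>
     (\<forall>i \<le> graph_diameter G. \<forall>x \<in> pverts G. \<forall>y \<in> pverts G. graph_dist G x y = i \<longrightarrow>
        card {z. (y, z) \<in> parcs G \<and> graph_dist G x z + 1 = i} = c i \<and>
        card {z. (y, z) \<in> parcs G \<and> graph_dist G x z = i + 1} = b i)"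

definition distance_regular :: "'a pair_pre_digraph \<Rightarrow> bool" where
  "distance_regular G \<longleftrightarrow>
     pair_graph G \<and> graph_connected G \<and> (\<exists>b c. intersection_numbers G b c)"

definition valency :: "'a pair_pre_digraph \<Rightarrow> nat" where
  "valency G = (THE k. \<exists>b c. intersection_numbers G b c \<and> k = b 0)"

text \<open>The rows and columns are indexed by an arbitrary but fixed enumeration of the vertices;
  another enumeration conjugates the matrix by a permutation matrix. As the matrix is real and
  symmetric, its real spectrum comprises all eigenvalues.\<close>

definition vertex_list :: "'a pair_pre_digraph \<Rightarrow> 'a list" where
  "vertex_list G = (SOME vs. distinct vs \<and> set vs = pverts G)"

definition adjacency_mat :: "'a pair_pre_digraph \<Rightarrow> real mat" where
  "adjacency_mat G = (let vs = vertex_list G; n = length vs in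
     mat n n (\<lambda>(i, j). if (vs ! i, vs ! j) \<in> parcs G then 1 else 0))"

definition smallest_eigenvalue :: "'a pair_pre_digraph \<Rightarrow> real" where
  "smallest_eigenvalue G = Min (spectrum (adjacency_mat G))"

definition graph_iso :: "'a pair_pre_digraph \<Rightarrow> 'b pair_pre_digraph \<Rightarrow> bool" where
  "graph_iso G H \<longleftrightarrow> digraph_iso (with_proj G) (with_proj H)"


lemma graph_iso_iff:
  assumes "pair_graph G" "pair_graph H"
  shows "graph_iso G H \<longleftrightarrow>
    (\<exists>f. bij_betw f (pverts G) (pverts H) \<and>
         (\<forall>u \<in> pverts G. \<forall>v \<in> pverts G. (u, v) \<in> parcs G \<longleftrightarrow> (f u, f v) \<in> parcs H))"
    (is "_ \<longleftrightarrow> ?R")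
proof -
  interpret G: pair_graph G by fact
  interpret H: pair_graph H by fact
  show ?thesis
  proof
    assume "graph_iso G H"
    then obtain h where h: "pre_digraph.digraph_isomorphism (with_proj G) h"
      and H: "with_proj H = app_iso h (with_proj G)"
      unfolding graph_iso_def digraph_iso_def by blast
    from H have pv: "pverts H = iso_verts h ` pverts G" and pa: "parcs H = iso_arcs h ` parcs G"
      and t: "iso_tail h = fst" and hd: "iso_head h = snd"
      by (metis verts_app_iso arcs_app_iso tail_app_iso head_app_iso with_proj_simps)+
    have inj: "inj_on (iso_verts h) (pverts G)"
      using h by (simp add: pre_digraph.digraph_isomorphism_def)
    have arc: "iso_arcs h a = (iso_verts h (fst a), iso_verts h (snd a))" if "a \<in> parcs G" for a
      using h that t hd by (simp add: pre_digraph.digraph_isomorphism_def prod_eq_iff)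
    have "(u, v) \<in> parcs G \<longleftrightarrow> (iso_verts h u, iso_verts h v) \<in> parcs H"
      if "u \<in> pverts G" "v \<in> pverts G" for u v
    proof
      assume "(u, v) \<in> parcs G" then show "(iso_verts h u, iso_verts h v) \<in> parcs H"
        unfolding pa using arc by (force intro: image_eqI)
    next
      assume "(iso_verts h u, iso_verts h v) \<in> parcs H"
      then obtain a where a: "a \<in> parcs G" "iso_arcs h a = (iso_verts h u, iso_verts h v)"
        unfolding pa by (metis imageE)
      then have "fst a = u" "snd a = v"
        using arc[OF a(1)] inj that G.arc_fst_in_verts G.arc_snd_in_verts
        by (auto dest: inj_onD)
      then show "(u, v) \<in> parcs G" using a(1) by (metis prod.collapse)
    qed
    then show ?R using inj pv by (intro exI[of _ "iso_verts h"]) (auto simp: bij_betw_def)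
  next
    assume ?R
    then obtain f where f: "bij_betw f (pverts G) (pverts H)"
      and E: "\<And>u v. u \<in> pverts G \<Longrightarrow> v \<in> pverts G \<Longrightarrow> (u, v) \<in> parcs G \<longleftrightarrow> (f u, f v) \<in> parcs H"
      by blast
    define h where "h = \<lparr> iso_verts = f, iso_arcs = map_prod f f,
      iso_head = snd, iso_tail = (fst :: 'b \<times> 'b \<Rightarrow> 'b) \<rparr>"
    have inj: "inj_on f (pverts G)" and im: "f ` pverts G = pverts H"
      using f by (auto simp: bij_betw_def)
    have sub: "parcs G \<subseteq> pverts G \<times> pverts G" by (auto dest: G.wellformed')
    have "inj_on (map_prod f f) (parcs G)"
      by (rule inj_on_subset[OF map_prod_inj_on[OF inj inj] sub])
    then have 1: "pre_digraph.digraph_isomorphism (with_proj G) h"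
      using inj G.wf_digraph by (simp add: pre_digraph.digraph_isomorphism_def h_def)
    have "parcs H = map_prod f f ` parcs G"
    proof (intro equalityI subsetI)
      fix e assume e: "e \<in> parcs H"
      then obtain u v where "u \<in> pverts G" "v \<in> pverts G" "e = (f u, f v)"
        using im H.arc_fst_in_verts[OF e] H.arc_snd_in_verts[OF e] by (metis imageE prod.collapse)
      then show "e \<in> map_prod f f ` parcs G" using E e by force
    qed (use E sub in auto)
    then have "with_proj H = app_iso h (with_proj G)"
      by (simp add: app_iso_def h_def with_proj_def im)
    with 1 show "graph_iso G H" unfolding graph_iso_def digraph_iso_def by blast
  qed
qed

lemma valency_eq:
  assumes "pverts G \<noteq> {}" "intersection_numbers G b c"
  shows "valency G = b 0"
proof -
  obtain x where x: "x \<in> pverts G" using assms by blast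
  have "pre_digraph.awalk (with_proj G) x [] x"
    using x by (simp add: pre_digraph.awalk_def pre_digraph.cas.simps)
  then have d: "graph_dist G x x = 0"
    unfolding graph_dist_def by (intro Least_eq_0) auto
  have "b' 0 = card {z. (x, z) \<in> parcs G \<and> graph_dist G x z = 1}"
    if "intersection_numbers G b' c'" for b' c'
    using that x d by (auto simp: intersection_numbers_def)
  then show ?thesis
    unfolding valency_def using assms(2) by (intro the_equality) (blast, metis)
qed

end

theory Submission
  imports Defs
begin

text \<open>
  Write \<open>k\<close> for the valency and let \<open>u\<close> be the cosine sequence of an eigenvalue \<open>\<theta> \<le> - \<alpha> k\<close>, with
  \<open>u 0 = 1\<close>. The matrix \<open>E x y = u (d x y)\<close> satisfies \<open>E\<^sup>2 = C E\<close> with \<open>C = (\<Sum>i. k\<^sub>i (u i)\<^sup>2)\<close>, where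
  \<open>k\<^sub>i\<close> is the size of a sphere of radius \<open>i\<close>, so \<open>E\<close> has rank \<open>card V / C\<close>, the multiplicity of
  \<open>\<theta>\<close>. Let \<open>t\<close> be the last index with \<open>c t < \<epsilon> k\<close>, \<open>\<epsilon> = \<alpha>\<^sup>2 / 4\<close>. Up to \<open>t\<close> the recurrence gives
  \<open>\<bar>u (i + 1)\<bar> \<ge> \<alpha> / 2 * \<bar>u i\<bar>\<close>, and beyond \<open>t\<close> the sphere sizes grow at most by the factor \<open>1 / \<epsilon>\<close>.
  Hence \<open>card V / C\<close> is bounded in terms of \<open>\<alpha>\<close> and \<open>D\<close> only. The neighbours of a vertex form a
  two-distance set in a Euclidean space of this dimension, which bounds \<open>k\<close>, provided that
  \<open>u 2 \<noteq> 1\<close>. If \<open>u 2 = 1\<close>, the graph is bipartite (without triangles) or complete multipartite (with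
  triangles), and both are excluded.
\<close>

section \<open>Gram matrices\<close>

text \<open>Multiples of orthogonal projections split off rank-one summands \<open>E x v * E v y / E v v\<close>; each
  step lowers the trace by \<open>C\<close>.\<close>

lemma gram_decomposition:
  fixes E :: "'a \<Rightarrow> 'a \<Rightarrow> real"
  assumes "finite V" "C > 0"
    and "\<And>x y. x \<in> V \<Longrightarrow> y \<in> V \<Longrightarrow> E x y = E y x"
    and "\<And>x y. x \<in> V \<Longrightarrow> y \<in> V \<Longrightarrow> (\<Sum>z\<in>V. E x z * E z y) = C * E x y"
    and "(\<Sum>x\<in>V. E x x) \<le> real N * C"
  shows "\<exists>p :: nat \<Rightarrow> 'a \<Rightarrow> real. \<forall>x\<in>V. \<forall>y\<in>V. E x y = (\<Sum>l<N. p l x * p l y)"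
  using assms(3-5)
proof (induction N arbitrary: E)
  case (0 E)
  \<comment> \<open>A diagonal entry is, up to the factor \<open>C\<close>, the squared norm of its
    row. So the trace is a sum of nonnegative terms, and a vanishing trace kills every row.\<close>
  have sq: "C * E x x = (\<Sum>z\<in>V. (E x z)\<^sup>2)" if "x \<in> V" for x
    unfolding 0(2)[OF that that, symmetric]
    by (rule sum.cong) (use 0(1)[OF that] in \<open>simp_all add: power2_eq_square\<close>)
  have nonneg: "E x x \<ge> 0" if "x \<in> V" for x
    using sq[OF that] \<open>C > 0\<close> sum_nonneg[of V "\<lambda>z. (E x z)\<^sup>2"]
    by (metis zero_le_mult_iff zero_le_power2 not_le)
  then have "E x x = 0" if "x \<in> V" for x
    using 0(3) that sum_nonneg_eq_0_iff[OF \<open>finite V\<close>, of "\<lambda>x. E x x"] sum_nonneg[of V "\<lambda>x. E x x"]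
    by simp
  then have "E x y = 0" if "x \<in> V" "y \<in> V" for x y
    using sq[OF that(1)] that sum_nonneg_eq_0_iff[OF \<open>finite V\<close>, of "\<lambda>z. (E x z)\<^sup>2"] by simp
  then show ?case by simp
next
  case (Suc N E)
  note sym = Suc.prems(1) and idem = Suc.prems(2)
  have sq: "C * E x x = (\<Sum>z\<in>V. (E x z)\<^sup>2)" if "x \<in> V" for x
    unfolding idem[OF that that, symmetric]
    by (rule sum.cong) (use sym[OF that] in \<open>simp_all add: power2_eq_square\<close>)
  show ?case
  proof (cases "\<forall>x\<in>V. E x x = 0")
    case True
    then have "E x y = 0" if "x \<in> V" "y \<in> V" for x y
      using sq[OF that(1)] that sum_nonneg_eq_0_iff[OF \<open>finite V\<close>, of "\<lambda>z. (E x z)\<^sup>2"] by simp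
    then show ?thesis by (intro exI[of _ "\<lambda>_ _. 0"]) simp
  next
    case False
    then obtain v where v: "v \<in> V" "E v v \<noteq> 0" by blast
    define e where "e = E v v"
    have "C * e \<ge> 0" unfolding e_def sq[OF v(1)] by (simp add: sum_nonneg)
    then have e: "e > 0" using v(2) \<open>C > 0\<close> by (simp add: e_def zero_le_mult_iff)
    define F where "F x y = E x y - E x v * E v y / e" for x y
    have "F x y = F y x" if "x \<in> V" "y \<in> V" for x y
      unfolding F_def using sym[OF that] sym[OF that(1) v(1)] sym[OF that(2) v(1)] by simp
    moreover have "(\<Sum>z\<in>V. F x z * F z y) = C * F x y" if xy: "x \<in> V" "y \<in> V" for x y
    proof -
      have "(\<Sum>z\<in>V. F x z * F z y) = (\<Sum>z\<in>V. E x z * E z y - E x v / e * (E v z * E z y)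
          - E v y / e * (E x z * E z v) + E x v * E v y / e\<^sup>2 * (E v z * E z v))"
        by (rule sum.cong) (use e in \<open>simp_all add: F_def field_simps power2_eq_square\<close>)
      also have "\<dots> = C * E x y - E x v / e * (C * E v y)
          - E v y / e * (C * E x v) + E x v * E v y / e\<^sup>2 * (C * e)"
        unfolding sum.distrib sum_subtractf sum_distrib_left[symmetric]
          idem[OF xy] idem[OF v(1) xy(2)] idem[OF xy(1) v(1)] idem[OF v(1) v(1)] e_def ..
      also have "\<dots> = C * F x y"
        using e by (simp add: F_def field_simps power2_eq_square)
      finally show ?thesis .
    qed
    moreover have "(\<Sum>x\<in>V. F x x) \<le> real N * C"
    proof -
      have "(\<Sum>x\<in>V. F x x) = (\<Sum>x\<in>V. E x x) - (\<Sum>x\<in>V. E v x * E x v) / e"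
        unfolding F_def sum_subtractf sum_divide_distrib by (simp add: mult.commute)
      also have "\<dots> = (\<Sum>x\<in>V. E x x) - C"
        unfolding idem[OF v(1) v(1)] using e by (simp add: e_def)
      finally show ?thesis using Suc.prems(3) by (simp add: algebra_simps)
    qed
    ultimately obtain p :: "nat \<Rightarrow> 'a \<Rightarrow> real"
      where p: "\<forall>x\<in>V. \<forall>y\<in>V. F x y = (\<Sum>l<N. p l x * p l y)"
      using Suc.IH by blast
    define q where "q l x = (if l < N then p l x else E x v / sqrt e)" for l x
    have "E x y = (\<Sum>l<Suc N. q l x * q l y)" if "x \<in> V" "y \<in> V" for x y
    proof -
      have "(\<Sum>l<Suc N. q l x * q l y) = F x y + E x v * E y v / e"
        using p that e by (simp add: q_def)
      then show ?thesis using sym[OF that(2) v(1)] by (simp add: F_def)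
    qed
    then show ?thesis by blast
  qed
qed

text \<open>Gaussian elimination, removing one equation together with one unknown in each induction
  step.\<close>

lemma nontrivial_kernel:
  fixes p :: "'i \<Rightarrow> 'a \<Rightarrow> real"
  assumes "finite I" "finite Y" "card I < card Y"
  shows "\<exists>f. (\<exists>y\<in>Y. f y \<noteq> 0) \<and> (\<forall>i\<in>I. (\<Sum>y\<in>Y. f y * p i y) = 0)"
  using assms
proof (induction I arbitrary: p Y rule: finite_induct)
  case empty
  then have "Y \<noteq> {}" by auto
  then show ?case by (intro exI[of _ "\<lambda>_. 1"]) auto
next
  case (insert i I)
  show ?case
  proof (cases "\<forall>y\<in>Y. p i y = 0")
    case True
    have "card I < card Y" using insert by simp
    from insert.IH[OF insert.prems(1) this, of p] obtain f
      where f: "\<exists>y\<in>Y. f y \<noteq> 0" "\<forall>j\<in>I. (\<Sum>y\<in>Y. f y * p j y) = 0" by blast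
    moreover have "(\<Sum>y\<in>Y. f y * p i y) = 0" using True by simp
    ultimately show ?thesis by blast
  next
    case False
    then obtain v where v: "v \<in> Y" "p i v \<noteq> 0" by blast
    \<comment> \<open>Equation \<open>i\<close> is solved for the unknown at the pivot
      \<open>v\<close> and substituted into the other equations; this gives the coefficients for the
      induction hypothesis.\<close>
    define Z where "Z = Y - {v}"
    have Z: "finite Z" "card I < card Z" using insert v by (auto simp: Z_def)
    from insert.IH[OF Z, of "\<lambda>j y. p j y - p j v * p i y / p i v"] obtain f
      where f: "\<exists>y\<in>Z. f y \<noteq> 0"
        "\<And>j. j \<in> I \<Longrightarrow> (\<Sum>y\<in>Z. f y * (p j y - p j v * p i y / p i v)) = 0" by blast
    define g where "g y = (if y = v then - (\<Sum>y\<in>Z. f y * p i y) / p i v else f y)" for y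
    have g: "(\<Sum>y\<in>Y. g y * p j y) = (\<Sum>y\<in>Z. f y * p j y) - (\<Sum>y\<in>Z. f y * p i y) / p i v * p j v"
      for j
    proof -
      have "(\<Sum>y\<in>Y. g y * p j y) = g v * p j v + (\<Sum>y\<in>Z. g y * p j y)"
        unfolding Z_def using insert.prems(1) v(1) by (rule sum.remove)
      also have "(\<Sum>y\<in>Z. g y * p j y) = (\<Sum>y\<in>Z. f y * p j y)"
        by (rule sum.cong) (auto simp: g_def Z_def)
      finally show ?thesis by (simp add: g_def)
    qed
    have "(\<Sum>y\<in>Y. g y * p j y) = 0" if "j \<in> I" for j
    proof -
      have "0 = (\<Sum>y\<in>Z. f y * p j y) - (\<Sum>y\<in>Z. f y * p i y) * (p j v / p i v)"
        unfolding f(2)[OF that, symmetric] sum_distrib_right sum_subtractf[symmetric]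
        by (rule sum.cong) (simp_all add: algebra_simps)
      then show ?thesis unfolding g by simp
    qed
    moreover have "(\<Sum>y\<in>Y. g y * p i y) = 0" unfolding g using v(2) by simp
    moreover have "\<exists>y\<in>Y. g y \<noteq> 0" using f(1) by (auto simp: g_def Z_def)
    ultimately show ?thesis by blast
  qed
qed

text \<open>Rank comparison: if \<open>Y\<close> were larger than \<open>I\<close>, some nonzero
  \<open>f\<close> would annihilate the left factor and hence the product, which multiplies
  \<open>f\<close> by \<open>e\<close>.\<close>

lemma card_le_of_diagonal_factorization:
  fixes p q :: "'i \<Rightarrow> 'a \<Rightarrow> real"
  assumes fin: "finite I" "finite Y" and "e \<noteq> 0"
    and diag: "\<And>x y. x \<in> Y \<Longrightarrow> y \<in> Y \<Longrightarrow> (\<Sum>i\<in>I. p i x * q i y) = (if x = y then e else 0)"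
  shows "card Y \<le> card I"
proof (rule ccontr)
  assume "\<not> card Y \<le> card I"
  then obtain f y where f: "\<And>i. i \<in> I \<Longrightarrow> (\<Sum>x\<in>Y. f x * p i x) = 0" and y: "y \<in> Y" "f y \<noteq> 0"
    using nontrivial_kernel[OF fin, of p] by (auto simp: not_le)
  have "0 = (\<Sum>i\<in>I. (\<Sum>x\<in>Y. f x * p i x) * q i y)" using f by simp
  also have "\<dots> = (\<Sum>x\<in>Y. f x * (\<Sum>i\<in>I. p i x * q i y))"
    unfolding sum_distrib_left sum_distrib_right by (subst sum.swap) (simp add: mult.assoc)
  also have "\<dots> = (\<Sum>x\<in>Y. if x = y then f x * e else 0)"
    by (rule sum.cong) (use diag y(1) in auto)
  also have "\<dots> = f y * e" using fin(2) y(1) by simp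
  finally show False using y(2) \<open>e \<noteq> 0\<close> by simp
qed

text \<open>The entrywise product of the Gram matrices shifted by \<open>s\<close> and \<open>t\<close> is a nonzero multiple of
  the identity, while each factor has rank at most \<open>N + 1\<close>.\<close>

lemma two_distance_card_bound:
  fixes E :: "'a \<Rightarrow> 'a \<Rightarrow> real" and p :: "nat \<Rightarrow> 'a \<Rightarrow> real"
  assumes "finite Y"
    and E: "\<And>x y. x \<in> Y \<Longrightarrow> y \<in> Y \<Longrightarrow> E x y = (\<Sum>l<N. p l x * p l y)"
    and one: "\<And>x. x \<in> Y \<Longrightarrow> E x x = 1"
    and two: "\<And>x y. x \<in> Y \<Longrightarrow> y \<in> Y \<Longrightarrow> x \<noteq> y \<Longrightarrow> E x y = s \<or> E x y = t"
    and st: "s \<noteq> 1" "t \<noteq> 1"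
  shows "card Y \<le> (N + 1)\<^sup>2"
proof -
  \<comment> \<open>The extra coordinate \<open>N\<close> contributes \<open>1 * (- r)\<close>,
    which turns the shifted entry \<open>E x y - r\<close> into an inner product.\<close>
  define P where "P l x = (if l < N then p l x else 1)" for l x
  define Q where "Q r l x = (if l < N then p l x else - r)" for r l x
  have PQ: "(\<Sum>l<Suc N. P l x * Q r l y) = E x y - r" if "x \<in> Y" "y \<in> Y" for x y r
    using E[OF that] by (simp add: P_def Q_def)
  define I where "I = {..<Suc N} \<times> {..<Suc N}"
  have "card Y \<le> card I"
  proof (rule card_le_of_diagonal_factorization)
    fix x y assume xy: "x \<in> Y" "y \<in> Y"
    have "(\<Sum>i\<in>I. (P (fst i) x * P (snd i) x) * (Q s (fst i) y * Q t (snd i) y))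
      = (\<Sum>l<Suc N. P l x * Q s l y) * (\<Sum>l<Suc N. P l x * Q t l y)"
      unfolding I_def sum_product sum.cartesian_product
      by (rule sum.cong) auto
    also have "\<dots> = (E x y - s) * (E x y - t)" unfolding PQ[OF xy] ..
    also have "\<dots> = (if x = y then (1 - s) * (1 - t) else 0)"
      using one[OF xy(1)] two[OF xy] by auto
    finally show "(\<Sum>i\<in>I. (P (fst i) x * P (snd i) x) * (Q s (fst i) y * Q t (snd i) y))
      = (if x = y then (1 - s) * (1 - t) else 0)" .
  qed (use assms in \<open>simp_all add: I_def\<close>)
  then show ?thesis by (simp add: I_def power2_eq_square)
qed

section \<open>Distance-regular metrics\<close>

text \<open>The metric is axiomatized so that the combinatorics need not mention walks:
  \<open>d_step\<close> is the triangle inequality along an edge, and \<open>d_pred\<close> supplies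
  the last edge of a geodesic. With \<open>d_le\<close> and \<open>d_attained\<close>,
  \<open>D\<close> is the exact diameter.\<close>

locale drg =
  fixes V :: "'a set" and adj :: "'a \<Rightarrow> 'a \<Rightarrow> bool" and d :: "'a \<Rightarrow> 'a \<Rightarrow> nat"
    and D :: nat and b c :: "nat \<Rightarrow> nat"
  assumes finite_V: "finite V"
    and adj_V: "adj x y \<Longrightarrow> x \<in> V \<and> y \<in> V"
    and adj_sym: "adj x y \<Longrightarrow> adj y x"
    and adj_irrefl: "\<not> adj x x"
    and d_refl: "x \<in> V \<Longrightarrow> d x x = 0"
    and d_0: "x \<in> V \<Longrightarrow> y \<in> V \<Longrightarrow> d x y = 0 \<Longrightarrow> x = y"
    and d_sym: "x \<in> V \<Longrightarrow> y \<in> V \<Longrightarrow> d x y = d y x"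
    and d_step: "adj x y \<Longrightarrow> z \<in> V \<Longrightarrow> d z y \<le> Suc (d z x)"
    and d_pred: "x \<in> V \<Longrightarrow> y \<in> V \<Longrightarrow> d x y = Suc i \<Longrightarrow> \<exists>z. adj z y \<and> d x z = i"
    and d_le: "x \<in> V \<Longrightarrow> y \<in> V \<Longrightarrow> d x y \<le> D"
    and d_attained: "\<exists>x\<in>V. \<exists>y\<in>V. d x y = D"
    and card_c: "x \<in> V \<Longrightarrow> y \<in> V \<Longrightarrow> card {z. adj y z \<and> Suc (d x z) = d x y} = c (d x y)"
    and card_b: "x \<in> V \<Longrightarrow> y \<in> V \<Longrightarrow> card {z. adj y z \<and> d x z = Suc (d x y)} = b (d x y)"
begin

section \<open>Intersection numbers\<close>

lemma finite_nbrs: "finite {z. adj y z \<and> P z}"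
  by (rule finite_subset[OF _ finite_V]) (use adj_V in auto)

lemma finite_nbrs': "finite {z. adj y z}"
  using finite_nbrs[of y "\<lambda>_. True"] by simp

lemma card_nbrs_pos:
  assumes "adj y z" "P z" shows "card {z. adj y z \<and> P z} > 0"
  using card_gt_0_iff[THEN iffD2, OF conjI, OF _ finite_nbrs[of y P]] assms by blast

lemma adj_iff: "x \<in> V \<Longrightarrow> y \<in> V \<Longrightarrow> adj x y \<longleftrightarrow> d x y = 1"
proof
  assume x: "x \<in> V" "y \<in> V" and "adj x y"
  then show "d x y = 1"
    using d_step[of x y x] d_refl[of x] d_0[of x y] adj_irrefl[of x] by force
next
  assume x: "x \<in> V" "y \<in> V" and "d x y = 1"
  then obtain z where "adj z y" "d x z = 0" using d_pred[of x y 0] by auto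
  then show "adj x y" using d_0[of x z] x adj_V by blast
qed

lemma degree: "y \<in> V \<Longrightarrow> card {z. adj y z} = b 0"
proof -
  assume y: "y \<in> V"
  have "d y z = Suc (d y y)" if "adj y z" for z
    using that adj_iff[OF y, of z] adj_V[OF that] d_refl[OF y] by simp
  then have "{z. adj y z} = {z. adj y z \<and> d y z = Suc (d y y)}" by blast
  then show ?thesis using card_b[OF y y] d_refl[OF y] by simp
qed

text \<open>Descends from a pair at distance \<open>D\<close>, one geodesic edge at a time.
  Relations between intersection numbers can then be read off from an actual pair of
  vertices.\<close>

lemma dist_exists:
  assumes "i \<le> D"
  shows "\<exists>x\<in>V. \<exists>y\<in>V. d x y = i"
  using assms
proof (induction rule: inc_induct)
  case base
  show ?case by (rule d_attained)
next
  case (step n)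
  then obtain x y where xy: "x \<in> V" "y \<in> V" "d x y = Suc n" by blast
  then obtain z where "adj z y" "d x z = n" using d_pred by blast
  then show ?case using xy(1) adj_V by blast
qed

text \<open>For \<open>i \<le> D\<close> the subtraction is not truncated, as \<open>abc_sum\<close>
  shows.\<close>

definition a :: "nat \<Rightarrow> nat" where "a i = b 0 - b i - c i"

text \<open>The tridiagonal intersection matrix: rows stand for the distance of a vertex from a base
  point, columns for that of its neighbours.\<close>

definition p :: "nat \<Rightarrow> nat \<Rightarrow> nat" where
  "p i j = (if j = Suc i then b i else if j = i then a i else if Suc j = i then c i else 0)"

lemma nbrs_split:
  assumes "x \<in> V" "y \<in> V"
  shows "card {z. adj y z \<and> d x z = d x y} + b (d x y) + c (d x y) = b 0"
proof -
  let ?A = "{z. adj y z \<and> d x z = d x y}" and ?B = "{z. adj y z \<and> d x z = Suc (d x y)}"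
    and ?C = "{z. adj y z \<and> Suc (d x z) = d x y}"
  have *: "d x z = d x y \<or> d x z = Suc (d x y) \<or> Suc (d x z) = d x y" if "adj y z" for z
    using d_step[OF that assms(1)] d_step[OF adj_sym[OF that] assms(1)] by linarith
  have "{z. adj y z} = (?A \<union> ?B) \<union> ?C"
    unfolding set_eq_iff Un_iff mem_Collect_eq by (intro allI) (metis *)
  then have "card ((?A \<union> ?B) \<union> ?C) = b 0"
    using degree[OF assms(2)] by (simp only:)
  moreover have "card ((?A \<union> ?B) \<union> ?C) = card (?A \<union> ?B) + card ?C"
    by (rule card_Un_disjoint) (simp_all add: finite_nbrs disjoint_iff)
  moreover have "card (?A \<union> ?B) = card ?A + card ?B"
    by (rule card_Un_disjoint) (simp_all add: finite_nbrs disjoint_iff)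
  ultimately show ?thesis
    using card_b[OF assms] card_c[OF assms] by linarith
qed

lemma card_nbrs_dist:
  assumes "x \<in> V" "y \<in> V"
  shows "card {z. adj y z \<and> d x z = j} = p (d x y) j"
proof -
  consider "j = Suc (d x y)" | "j = d x y" | "Suc j = d x y"
    | "j \<noteq> Suc (d x y)" "j \<noteq> d x y" "Suc j \<noteq> d x y" by argo
  then show ?thesis
  proof cases
    case 1
    then show ?thesis using card_b[OF assms] by (simp add: p_def)
  next
    case 2
    then show ?thesis using nbrs_split[OF assms] unfolding p_def a_def by simp
  next
    case 3
    have "{z. adj y z \<and> d x z = j} = {z. adj y z \<and> Suc (d x z) = d x y}"
      unfolding 3[symmetric] by simp
    then show ?thesis using card_c[OF assms] unfolding 3[symmetric] by (simp add: p_def)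
  next
    case 4
    have "d x z \<noteq> j" if "adj y z" for z
      using 4 d_step[OF that assms(1)] d_step[OF adj_sym[OF that] assms(1)] by linarith
    then have "{z. adj y z \<and> d x z = j} = {}" by blast
    then have "card {z. adj y z \<and> d x z = j} = 0" by (simp only: card.empty)
    then show ?thesis using 4 by (simp add: p_def)
  qed
qed

lemma abc_sum: "i \<le> D \<Longrightarrow> a i + b i + c i = b 0"
proof -
  assume "i \<le> D"
  then obtain x y where "x \<in> V" "y \<in> V" "d x y = i" using dist_exists by blast
  then show ?thesis using nbrs_split[of x y] by (simp add: a_def)
qed

lemma b_le: "i \<le> D \<Longrightarrow> b i \<le> b 0"
  using abc_sum[of i] by simp

lemma c_0: "c 0 = 0"
proof -
  obtain x where x: "x \<in> V" using d_attained by blast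
  show ?thesis using card_c[OF x x] d_refl[OF x] by simp
qed

lemma a_0: "a 0 = 0"
  using abc_sum[of 0] by simp

lemma b_D: "b D = 0"
proof -
  obtain x y where xy: "x \<in> V" "y \<in> V" "d x y = D" using d_attained by blast
  have "d x z \<noteq> Suc D" if "adj y z" for z using d_le[OF xy(1), of z] adj_V[OF that] by auto
  then have "{z. adj y z \<and> d x z = Suc D} = {}" by blast
  then show ?thesis using card_b[OF xy(1,2)] unfolding xy(3) by (simp only: card.empty)
qed

lemma c_pos:
  assumes "Suc i \<le> D" shows "c (Suc i) > 0"
proof -
  obtain x y where xy: "x \<in> V" "y \<in> V" "d x y = Suc i" using dist_exists assms by blast
  then obtain z where "adj z y" "d x z = i" using d_pred by blast
  then have "card {z. adj y z \<and> Suc (d x z) = d x y} > 0"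
    using xy(3) adj_sym[of z y] by (intro card_nbrs_pos) simp_all
  then show ?thesis unfolding card_c[OF xy(1,2)] unfolding xy(3) .
qed

lemma b_pos:
  assumes "Suc i \<le> D" shows "b i > 0"
proof -
  obtain x y where xy: "x \<in> V" "y \<in> V" "d x y = Suc i" using dist_exists assms by blast
  then obtain z where z: "adj z y" "d x z = i" using d_pred by blast
  then have zV: "z \<in> V" using adj_V by blast
  have "card {y. adj z y \<and> d x y = Suc (d x z)} > 0"
    using z xy(3) by (intro card_nbrs_pos) simp_all
  then show ?thesis unfolding card_b[OF xy(1) zV] unfolding z(2) .
qed

lemma c_1: "D \<ge> 1 \<Longrightarrow> c 1 = 1"
proof -
  assume "D \<ge> 1"
  then obtain x y where xy: "x \<in> V" "y \<in> V" "d x y = 1" using dist_exists by blast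
  have "z = x" if "adj y z" "Suc (d x z) = d x y" for z
  proof -
    have "d x z = 0" using that(2) xy(3) by simp
    then show ?thesis using d_0[OF xy(1), of z] adj_V[OF that(1)] by simp
  qed
  moreover have "adj y x" "Suc (d x x) = d x y"
    using xy(3) d_refl[OF xy(1)] adj_iff[OF xy(1,2)] adj_sym[of x y] by simp_all
  ultimately have "adj y z \<and> Suc (d x z) = d x y \<longleftrightarrow> z = x" for z by blast
  then have "{z. adj y z \<and> Suc (d x z) = d x y} = {x}" by simp
  then show ?thesis using card_c[OF xy(1,2)] xy(3) by simp
qed

text \<open>Replacing \<open>x\<close> by its successor \<open>x'\<close> on a geodesic from \<open>x\<close> to \<open>y\<close>, the neighbours of \<open>y\<close>
  closer to \<open>x'\<close> are also closer to \<open>x\<close>.\<close>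

lemma c_mono_Suc:
  assumes "Suc i \<le> D" shows "c i \<le> c (Suc i)"
proof -
  obtain x y where xy: "x \<in> V" "y \<in> V" "d x y = Suc i" using dist_exists assms by blast
  have "d y x = Suc i" using d_sym[OF xy(1,2)] xy(3) by simp
  then obtain x' where x': "adj x' x" "d y x' = i" using d_pred[OF xy(2,1)] by blast
  have x'V: "x' \<in> V" using adj_V[OF x'(1)] by simp
  have dx': "d x' y = i" using x'(2) d_sym[OF x'V xy(2)] by simp
  have "{z. adj y z \<and> Suc (d x' z) = d x' y} \<subseteq> {z. adj y z \<and> Suc (d x z) = d x y}"
  proof clarify
    fix z assume z: "adj y z" "Suc (d x' z) = d x' y"
    have zV: "z \<in> V" using z adj_V by blast
    have "d x z \<le> Suc (d x' z)"
      using d_step[OF x'(1) zV] d_sym[OF zV xy(1)] d_sym[OF zV x'V] by simp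
    moreover have "d x y \<le> Suc (d x z)" using d_step[OF adj_sym[OF z(1)] xy(1)] .
    ultimately show "Suc (d x z) = d x y" using z xy dx' by simp
  qed
  then have "card {z. adj y z \<and> Suc (d x' z) = d x' y} \<le> card {z. adj y z \<and> Suc (d x z) = d x y}"
    by (rule card_mono[OF finite_nbrs])
  then show ?thesis unfolding card_c[OF xy(1,2)] card_c[OF x'V xy(2)] unfolding xy(3) dx' .
qed

lemma c_mono: "i \<le> j \<Longrightarrow> j \<le> D \<Longrightarrow> c i \<le> c j"
proof (induction rule: dec_induct)
  case (step n)
  then show ?case using c_mono_Suc[of n] by simp
qed simp

section \<open>Spheres and distance matrices\<close>

definition sphere_sum :: "nat \<Rightarrow> ('a \<Rightarrow> real) \<Rightarrow> 'a \<Rightarrow> real" where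
  "sphere_sum i f x = (\<Sum>y | y \<in> V \<and> d x y = i. f y)"

lemma sum_by_distance:
  assumes "x \<in> V"
  shows "(\<Sum>y\<in>V. g (d x y) * f y) = (\<Sum>i\<le>D. g i * sphere_sum i f x)"
proof -
  have "(\<Sum>i\<le>D. g i * sphere_sum i f x) = (\<Sum>i\<le>D. \<Sum>y | y \<in> V \<and> d x y = i. g (d x y) * f y)"
    by (intro sum.cong) (simp_all add: sphere_sum_def sum_distrib_left)
  also have "\<dots> = (\<Sum>y\<in>V. g (d x y) * f y)"
    using d_le assms finite_V by (intro sum.group) auto
  finally show ?thesis by simp
qed

text \<open>Double counting of adjacent pairs: a vertex \<open>y\<close> at distance
  \<open>j\<close> from \<open>x\<close> has \<open>p j i\<close> neighbours \<open>z\<close> on the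
  sphere of radius \<open>i\<close>. In terms of the adjacency matrix \<open>A\<close> and the
  distance matrices \<open>A_i\<close>, this is the recurrence
  \<open>A_i A = sum_j p j i A_j\<close>.\<close>

lemma sum_sphere_nbrs:
  assumes x: "x \<in> V"
  shows "(\<Sum>z | z \<in> V \<and> d x z = i. \<Sum>y | adj z y. f y) = (\<Sum>j\<le>D. p j i * sphere_sum j f x)"
proof -
  have "(\<Sum>z | z \<in> V \<and> d x z = i. \<Sum>y | adj z y. f y)
      = (\<Sum>z | z \<in> V \<and> d x z = i. \<Sum>y\<in>V. of_bool (adj z y) * f y)"
  proof (rule sum.cong[OF refl])
    fix z
    have "V \<inter> {y. adj z y} = {y. adj z y}" using adj_V by blast
    then show "(\<Sum>y | adj z y. f y) = (\<Sum>y\<in>V. of_bool (adj z y) * f y)"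
      using finite_V by simp
  qed
  also have "\<dots> = (\<Sum>y\<in>V. \<Sum>z | z \<in> V \<and> d x z = i. of_bool (adj z y) * f y)"
    by (rule sum.swap)
  also have "\<dots> = (\<Sum>y\<in>V. p (d x y) i * f y)"
  proof (rule sum.cong[OF refl])
    fix y assume y: "y \<in> V"
    have "(\<Sum>z | z \<in> V \<and> d x z = i. of_bool (adj z y) * f y)
      = (\<Sum>z \<in> {z \<in> V. d x z = i} \<inter> {z. adj z y}. f y)"
      by (rule sum_of_bool_mult_eq) (simp add: finite_V)
    also have "{z \<in> V. d x z = i} \<inter> {z. adj z y} = {z. adj y z \<and> d x z = i}"
      using adj_V adj_sym by blast
    finally show "(\<Sum>z | z \<in> V \<and> d x z = i. of_bool (adj z y) * f y) = p (d x y) i * f y"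
      using card_nbrs_dist[OF x y] by simp
  qed
  also have "\<dots> = (\<Sum>j\<le>D. p j i * sphere_sum j f x)"
    using sum_by_distance[OF x, of "\<lambda>j. p j i" f] by simp
  finally show ?thesis .
qed

text \<open>The product formula makes the size visibly independent of the centre;
  \<open>card_sphere\<close> shows that it counts vertices.\<close>

primrec sphere_size :: "nat \<Rightarrow> real" where
  "sphere_size 0 = 1"
| "sphere_size (Suc i) = sphere_size i * b i / c (Suc i)"

lemma sphere_size_pos: "i \<le> D \<Longrightarrow> sphere_size i > 0"
  by (induction i) (use b_pos c_pos in auto)

text \<open>Only indices differing by one need an argument, and for them this is the recursion of
  \<open>sphere_size\<close>. The lemma serves to exchange rows and columns of
  \<open>p\<close>.\<close>

lemma sphere_size_p_sym:
  assumes "i \<le> D" "j \<le> D"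
  shows "sphere_size i * p i j = sphere_size j * p j i"
  using c_pos[of i] c_pos[of j] assms
  by (auto simp: p_def)

text \<open>Column \<open>m\<close> of \<open>p\<close> vanishes beyond row \<open>m + 1\<close>, so
  the last term can be isolated and, \<open>c (Suc m)\<close> being positive, solved for.\<close>

lemma p_sum_Suc:
  fixes g :: "nat \<Rightarrow> real"
  assumes "m < D"
  shows "(\<Sum>j\<le>D. p j m * g j) = (\<Sum>j\<le>m. p j m * g j) + c (Suc m) * g (Suc m)"
proof -
  have "(\<Sum>j\<le>D. p j m * g j) = (\<Sum>j\<le>Suc m. p j m * g j)"
    using assms by (intro sum.mono_neutral_right) (auto simp: p_def)
  then show ?thesis by (simp add: p_def)
qed

lemma card_sphere:
  assumes x: "x \<in> V" and "i \<le> D"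
  shows "card {y \<in> V. d x y = i} = sphere_size i"
  using assms(2)
proof (induction i)
  case 0
  have "{y \<in> V. d x y = 0} = {x}" using x d_refl d_0 by auto
  then show ?case by simp
next
  case (Suc i)
  \<comment> \<open>For the indicator function of the next sphere, \<open>sum_sphere_nbrs\<close>
    counts the edges between the spheres of radius \<open>i\<close> and \<open>i + 1\<close> from
    both sides.\<close>
  define f where "f y = (of_bool (d x y = Suc i) :: real)" for y
  have S: "sphere_sum j f x = (if j = Suc i then card {y \<in> V. d x y = Suc i} else 0)" for j
    unfolding sphere_sum_def f_def by simp
  have "(\<Sum>y | adj z y. f y) = b i" if z: "z \<in> V" "d x z = i" for z
  proof -
    have "{y. adj z y} \<inter> {y. d x y = Suc i} = {y. adj z y \<and> d x y = Suc i}" by blast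
    then have "(\<Sum>y | adj z y. f y) = card {y. adj z y \<and> d x y = Suc i}"
      unfolding f_def using finite_nbrs'[of z] by simp
    then show ?thesis using card_b[OF x z(1)] z(2) by simp
  qed
  then have "(\<Sum>z | z \<in> V \<and> d x z = i. \<Sum>y | adj z y. f y) = card {y \<in> V. d x y = i} * b i"
    by simp
  moreover have "(\<Sum>z | z \<in> V \<and> d x z = i. \<Sum>y | adj z y. f y)
      = c (Suc i) * card {y \<in> V. d x y = Suc i}"
    unfolding sum_sphere_nbrs[OF x]  using Suc.prems p_sum_Suc[of i "\<lambda>j. sphere_sum j f x"]
    by (simp add: S)
  ultimately show ?case using c_pos[of i] Suc by (simp add: field_simps)
qed

lemma card_V: "real (card V) = (\<Sum>i\<le>D. sphere_size i)"
proof -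
  obtain x where x: "x \<in> V" using d_attained by blast
  have "real (card V) = (\<Sum>i\<le>D. real (card {y \<in> V. d x y = i}))"
    using sum_by_distance[OF x, of "\<lambda>_. 1" "\<lambda>_. 1"] by (simp add: sphere_sum_def)
  then show ?thesis using card_sphere[OF x] by simp
qed

lemma sphere_size_le: "i \<le> D \<Longrightarrow> sphere_size i \<le> real (b 0) ^ i"
proof (induction i)
  case (Suc i)
  have "sphere_size (Suc i) \<le> sphere_size i * b i / 1"
    unfolding sphere_size.simps
    using c_pos[OF Suc.prems] sphere_size_pos[of i] Suc.prems
    by (intro divide_left_mono) auto
  also have "\<dots> \<le> real (b 0) ^ i * b 0"
    using Suc b_le[of i] by (auto intro!: mult_mono)
  finally show ?case by (simp add: mult.commute)
qed simp

lemma card_V_le: "card V \<le> (\<Sum>i\<le>D. b 0 ^ i)"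
proof -
  have "real (card V) \<le> (\<Sum>i\<le>D. real (b 0) ^ i)"
    unfolding card_V by (intro sum_mono sphere_size_le) simp
  also have "\<dots> = real (\<Sum>i\<le>D. b 0 ^ i)" by simp
  finally show ?thesis by linarith
qed

end

section \<open>Cosine sequences\<close>

context drg
begin

definition eigen :: "real \<Rightarrow> ('a \<Rightarrow> real) \<Rightarrow> bool" where
  "eigen \<theta> f \<longleftrightarrow> (\<forall>x\<in>V. (\<Sum>y | adj x y. f y) = \<theta> * f x)"

lemma sphere_sum_0:
  assumes x: "x \<in> V" shows "sphere_sum 0 f x = f x"
proof -
  have "{y. y \<in> V \<and> d x y = 0} = {x}" using x d_refl d_0 by auto
  then show ?thesis by (simp add: sphere_sum_def)
qed

lemma eigen_sphere_sum_rec: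
  assumes "eigen \<theta> f" and x: "x \<in> V"
  shows "(\<Sum>j\<le>D. p j i * sphere_sum j f x) = \<theta> * sphere_sum i f x"
proof -
  have "(\<Sum>z | z \<in> V \<and> d x z = i. \<Sum>y | adj z y. f y) = (\<Sum>z | z \<in> V \<and> d x z = i. \<theta> * f z)"
    by (rule sum.cong) (use assms in \<open>auto simp: eigen_def\<close>)
  then show ?thesis
    unfolding sum_sphere_nbrs[OF x] by (simp add: sphere_sum_def sum_distrib_left)
qed

text \<open>A distance matrix is a polynomial in the adjacency matrix and thus acts as a scalar on
  an eigenspace. The recurrence produces this scalar by induction; \<open>r\<close> is chosen before
  \<open>f\<close>, hence common to all eigenfunctions.\<close>

lemma eigen_sphere_sum_scalar:
  assumes "i \<le> D"
  shows "\<exists>r. \<forall>f. eigen \<theta> f \<longrightarrow> (\<forall>x\<in>V. sphere_sum i f x = r * f x)"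
  using assms
proof (induction i rule: less_induct)
  case (less i)
  show ?case
  proof (cases i)
    case 0
    then show ?thesis using sphere_sum_0 by (intro exI[of _ 1]) simp
  next
    case (Suc m)
    have "\<forall>j\<in>{..m}. \<exists>r. \<forall>f. eigen \<theta> f \<longrightarrow> (\<forall>x\<in>V. sphere_sum j f x = r * f x)"
      using less Suc by simp
    from bchoice[OF this] obtain w
      where w: "\<And>j f x. j \<le> m \<Longrightarrow> eigen \<theta> f \<Longrightarrow> x \<in> V \<Longrightarrow> sphere_sum j f x = w j * f x"
      by auto
    have "sphere_sum i f x = (\<theta> * w m - (\<Sum>j\<le>m. p j m * w j)) / c i * f x"
      if f: "eigen \<theta> f" and x: "x \<in> V" for f x
    proof -
      have "(\<Sum>j\<le>m. p j m * sphere_sum j f x) + c i * sphere_sum i f x = \<theta> * sphere_sum m f x"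
        using eigen_sphere_sum_rec[OF f x, of m] p_sum_Suc[of m "\<lambda>j. sphere_sum j f x"] less.prems Suc
        by simp
      moreover have "(\<Sum>j\<le>m. p j m * sphere_sum j f x) = (\<Sum>j\<le>m. p j m * w j) * f x"
        unfolding sum_distrib_right by (rule sum.cong) (use w[OF _ f x] in simp_all)
      moreover have "sphere_sum m f x = w m * f x" using w[OF _ f x] by simp
      moreover have "c i > 0" using c_pos less.prems Suc by simp
      ultimately show ?thesis by (simp add: field_simps)
    qed
    then show ?thesis by blast
  qed
qed

text \<open>\<open>u i\<close> is the average of an eigenfunction over a sphere of radius
  \<open>i\<close>, relative to its value at the centre. The nonzero value \<open>f x\<close>
  permits normalization and cancellation.\<close>

lemma cosine_sequence:
  assumes f: "eigen \<theta> f" and x: "x \<in> V" "f x \<noteq> 0"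
  obtains u :: "nat \<Rightarrow> real" where "u 0 = 1"
    and "\<And>i. i \<le> D \<Longrightarrow> (\<Sum>j\<le>D. p i j * u j) = \<theta> * u i"
    and "\<And>f i x. eigen \<theta> f \<Longrightarrow> i \<le> D \<Longrightarrow> x \<in> V \<Longrightarrow> sphere_sum i f x = sphere_size i * u i * f x"
proof -
  have "\<forall>i\<in>{..D}. \<exists>r. \<forall>f. eigen \<theta> f \<longrightarrow> (\<forall>x\<in>V. sphere_sum i f x = r * f x)"
    using eigen_sphere_sum_scalar by simp
  from bchoice[OF this] obtain w
    where w: "\<And>j f x. eigen \<theta> f \<Longrightarrow> j \<le> D \<Longrightarrow> x \<in> V \<Longrightarrow> sphere_sum j f x = w j * f x"
    by auto
  define u where "u i = w i / sphere_size i" for i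
  have wu: "w i = sphere_size i * u i" if "i \<le> D" for i
    using sphere_size_pos[OF that] by (simp add: u_def)
  show ?thesis
  proof (rule that[of u])
    show "u 0 = 1" using w[OF f _ x(1), of 0] sphere_sum_0[OF x(1), of f] x(2) by (simp add: u_def)
  next
    fix i assume i: "i \<le> D"
    \<comment> \<open>The recurrence for sphere sums runs along columns of \<open>p\<close>;
      weighting by sphere sizes turns it into one along rows.\<close>
    have "(\<Sum>j\<le>D. p j i * sphere_sum j f x) = sphere_size i * (\<Sum>j\<le>D. p i j * u j) * f x"
      unfolding sum_distrib_left sum_distrib_right
    proof (rule sum.cong)
      fix j assume "j \<in> {..D}"
      then have j: "j \<le> D" by simp
      show "p j i * sphere_sum j f x = sphere_size i * (p i j * u j) * f x"
        unfolding w[OF f j x(1)] wu[OF j] using sphere_size_p_sym[OF i j]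
        by (simp add: mult.assoc[symmetric])
    qed simp
    from trans[OF this[symmetric] eigen_sphere_sum_rec[OF f x(1)]]
    have "sphere_size i * (\<Sum>j\<le>D. p i j * u j) * f x = \<theta> * (sphere_size i * u i * f x)"
      unfolding w[OF f i x(1)] wu[OF i] .
    then have "sphere_size i * f x * (\<Sum>j\<le>D. p i j * u j) = sphere_size i * f x * (\<theta> * u i)"
      by (simp only: mult_ac)
    then show "(\<Sum>j\<le>D. p i j * u j) = \<theta> * u i"
      unfolding mult_cancel_left using sphere_size_pos[OF i] x(2) by simp
  next
    fix f i x assume "eigen \<theta> f" "i \<le> D" "x \<in> V"
    then show "sphere_sum i f x = sphere_size i * u i * f x" using w wu by simp
  qed
qed

end

text \<open>\<open>u_sphere\<close> is demanded for every eigenfunction because it is applied to the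
  functions \<open>\<lambda>x. u (d y x)\<close>, not only to the eigenfunction that produced
  \<open>u\<close>.\<close>

locale drg_cosines = drg +
  fixes \<theta> :: real and u :: "nat \<Rightarrow> real"
  assumes D_ge_2: "D \<ge> 2"
    and u_0: "u 0 = 1"
    and u_row: "i \<le> D \<Longrightarrow> (\<Sum>j\<le>D. p i j * u j) = \<theta> * u i"
    and u_sphere: "eigen \<theta> f \<Longrightarrow> i \<le> D \<Longrightarrow> x \<in> V \<Longrightarrow>
      sphere_sum i f x = sphere_size i * u i * f x"
begin

section \<open>The Gram matrix of cosines\<close>

lemma eigen_cosine:
  assumes y: "y \<in> V"
  shows "eigen \<theta> (\<lambda>x. u (d y x))"
  unfolding eigen_def
proof
  fix x assume x: "x \<in> V"
  have "(\<Sum>z | adj x z. u (d y z)) = (\<Sum>j\<le>D. \<Sum>z | z \<in> {z. adj x z} \<and> d y z = j. u (d y z))"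
    using d_le[OF y] adj_V finite_nbrs' by (intro sum.group[symmetric]) auto
  also have "\<dots> = (\<Sum>j\<le>D. p (d y x) j * u j)"
  proof (rule sum.cong)
    fix j
    have "(\<Sum>z | z \<in> {z. adj x z} \<and> d y z = j. u (d y z)) = card {z. adj x z \<and> d y z = j} * u j"
      by simp
    then show "(\<Sum>z | z \<in> {z. adj x z} \<and> d y z = j. u (d y z)) = p (d y x) j * u j"
      unfolding card_nbrs_dist[OF y x] .
  qed simp
  also have "\<dots> = \<theta> * u (d y x)" using u_row d_le[OF y x] by simp
  finally show "(\<Sum>z | adj x z. u (d y z)) = \<theta> * u (d y x)" .
qed

definition C :: real where "C = (\<Sum>i\<le>D. sphere_size i * (u i)\<^sup>2)"

lemma C_ge:
  assumes "t \<le> D" shows "(\<Sum>i\<le>t. sphere_size i * (u i)\<^sup>2) \<le> C"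
  unfolding C_def using assms
  by (intro sum_mono2) (auto intro!: mult_nonneg_nonneg less_imp_le[OF sphere_size_pos])

lemma C_pos: "C > 0"
  using C_ge[of 0] by (simp add: u_0)

text \<open>Each row of the cosine matrix is an eigenfunction by \<open>eigen_cosine\<close>, so
  summing it over the spheres around \<open>x\<close> returns, by \<open>u_sphere\<close>, a
  multiple of its entry at \<open>x\<close>.\<close>

lemma cosine_square:
  assumes x: "x \<in> V" and y: "y \<in> V"
  shows "(\<Sum>z\<in>V. u (d x z) * u (d z y)) = C * u (d x y)"
proof -
  have "(\<Sum>z\<in>V. u (d x z) * u (d z y)) = (\<Sum>z\<in>V. u (d x z) * u (d y z))"
    by (rule sum.cong) (use d_sym[OF y] in auto)
  also have "\<dots> = (\<Sum>i\<le>D. u i * sphere_sum i (\<lambda>z. u (d y z)) x)"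
    by (rule sum_by_distance[OF x])
  also have "\<dots> = (\<Sum>i\<le>D. sphere_size i * (u i)\<^sup>2 * u (d x y))"
    by (rule sum.cong)
      (use u_sphere[OF eigen_cosine[OF y] _ x] d_sym[OF x y] in \<open>simp_all add: power2_eq_square\<close>)
  finally show ?thesis by (simp add: C_def sum_distrib_right)
qed

text \<open>Equality case of the Cauchy-Schwarz inequality: by \<open>cosine_square\<close> all rows
  of the cosine matrix have squared norm \<open>C\<close>, and the rows of \<open>x\<close> and
  \<open>y\<close> have inner product \<open>s * C\<close> with \<open>s = 1\<close> or
  \<open>s = - 1\<close>.\<close>

lemma proportional_rows:
  assumes x: "x \<in> V" and y: "y \<in> V" and "s\<^sup>2 = 1" and "u (d x y) = s" and z: "z \<in> V"
  shows "u (d x z) = s * u (d y z)"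
proof -
  have sq: "(\<Sum>z\<in>V. u (d x z) * u (d y z)) = C * u (d x y)" if "x \<in> V" "y \<in> V" for x y
    unfolding cosine_square[OF that, symmetric] by (rule sum.cong) (use d_sym[OF that(2)] in auto)
  have "(\<Sum>z\<in>V. (u (d x z) - s * u (d y z))\<^sup>2)
     = (\<Sum>z\<in>V. u (d x z) * u (d x z) - 2 * s * (u (d x z) * u (d y z)) + s\<^sup>2 * (u (d y z) * u (d y z)))"
    by (rule sum.cong) (simp_all add: power2_eq_square algebra_simps)
  also have "\<dots> = C * 1 - 2 * s * (C * s) + s\<^sup>2 * (C * 1)"
    unfolding sum.distrib sum_subtractf sum_distrib_left[symmetric] sq[OF x x] sq[OF x y] sq[OF y y]
      d_refl[OF x] d_refl[OF y] u_0 assms(4) ..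
  also have "\<dots> = 0" using assms(3) by (simp add: power2_eq_square algebra_simps)
  finally have "\<forall>z\<in>V. (u (d x z) - s * u (d y z))\<^sup>2 = 0"
    using sum_nonneg_eq_0_iff[OF finite_V, of "\<lambda>z. (u (d x z) - s * u (d y z))\<^sup>2"] by simp
  then show ?thesis using z by simp
qed

text \<open>The cosine matrix has trace \<open>card V\<close>, so \<open>gram_decomposition\<close>
  represents the vertices by vectors in dimension \<open>N\<close>. Distinct neighbours of
  \<open>x0\<close> are at distance 1 or 2 from each other and form a two-distance set.\<close>

lemma valency_le_if_small_rank:
  assumes "u 1 \<noteq> 1" "u 2 \<noteq> 1" and N: "real (card V) \<le> real N * C"
  shows "b 0 \<le> (N + 1)\<^sup>2"
proof -
  have "\<exists>p :: nat \<Rightarrow> 'a \<Rightarrow> real. \<forall>x\<in>V. \<forall>y\<in>V. u (d x y) = (\<Sum>l<N. p l x * p l y)"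
  proof (rule gram_decomposition[OF finite_V C_pos])
    show "(\<Sum>x\<in>V. u (d x x)) \<le> real N * C" using N by (simp add: d_refl u_0)
  qed (use d_sym cosine_square in auto)
  then obtain q :: "nat \<Rightarrow> 'a \<Rightarrow> real"
    where q: "\<And>x y. x \<in> V \<Longrightarrow> y \<in> V \<Longrightarrow> u (d x y) = (\<Sum>l<N. q l x * q l y)"
    by blast
  obtain x0 where x0: "x0 \<in> V" using d_attained by blast
  have "card {y. adj x0 y} \<le> (N + 1)\<^sup>2"
  proof (rule two_distance_card_bound[where E = "\<lambda>x y. u (d x y)" and s = "u 1" and t = "u 2"])
    fix x y assume xy: "x \<in> {y. adj x0 y}" "y \<in> {y. adj x0 y}"
    then have V: "x \<in> V" "y \<in> V" using adj_V by auto
    show "u (d x y) = (\<Sum>l<N. q l x * q l y)" using q V .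
    assume "x \<noteq> y"
    then have "d x y \<noteq> 0" using d_0 V by blast
    moreover have "d x y \<le> Suc (Suc 0)"
      using d_step[of x0 y x] d_sym[OF V(1) x0] adj_iff[OF x0 V(1)] xy V by simp
    ultimately have "d x y = 1 \<or> d x y = 2" by linarith
    then show "u (d x y) = u 1 \<or> u (d x y) = u 2" by metis
  qed (use assms finite_nbrs' d_refl u_0 adj_V in auto)
  then show ?thesis using degree[OF x0] by simp
qed

section \<open>Three-term recurrence and growth of spheres\<close>

lemma u_1: "b 0 * u 1 = \<theta>"
proof -
  have "(\<Sum>j\<le>D. p 0 j * u j) = (\<Sum>j\<in>{1}. p 0 j * u j)"
    using D_ge_2 by (intro sum.mono_neutral_right) (auto simp: p_def a_0)
  then show ?thesis using u_row[of 0] by (simp add: p_def u_0)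
qed

lemma u_Suc:
  assumes "Suc i \<le> D"
  shows "c (Suc i) * u i + a (Suc i) * u (Suc i) + b (Suc i) * u (Suc (Suc i)) = \<theta> * u (Suc i)"
\<comment> \<open>For \<open>Suc i = D\<close> nothing is known about \<open>u (Suc D)\<close>, but
  its coefficient \<open>b D\<close> is zero, which keeps the recurrence uniform.\<close>
proof (cases "Suc i = D")
  case True
  have "(\<Sum>j\<le>D. p (Suc i) j * u j) = (\<Sum>j\<in>{i, Suc i}. p (Suc i) j * u j)"
    unfolding True[symmetric] by (intro sum.mono_neutral_right) (auto simp: p_def)
  moreover have "b (Suc i) = 0" using b_D True by simp
  ultimately show ?thesis using u_row[OF assms] by (simp add: p_def)
next
  case False
  have "(\<Sum>j\<le>D. p (Suc i) j * u j) = (\<Sum>j\<in>{i, Suc i, Suc (Suc i)}. p (Suc i) j * u j)"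
    using assms False by (intro sum.mono_neutral_right) (auto simp: p_def)
  then show ?thesis using u_row[OF assms] by (simp add: p_def)
qed

lemma valency_pos: "b 0 > 0"
  using b_pos[of 0] D_ge_2 by simp

text \<open>In the recurrence the term with \<open>u (Suc j)\<close> has size at least
  \<open>\<alpha> * b 0 * \<bar>u (Suc j)\<bar>\<close>, while the small \<open>c\<close> keeps the
  term with \<open>u j\<close> below half of that. The rest must be carried by
  \<open>u (Suc (Suc j))\<close>, whose coefficient is at most \<open>b 0\<close>.\<close>

lemma cosine_decay:
  fixes \<alpha> :: real
  assumes \<alpha>: "0 < \<alpha>" and \<theta>: "\<theta> \<le> - \<alpha> * b 0"
    and small: "\<And>j. j \<le> i \<Longrightarrow> c j < \<alpha>\<^sup>2 / 4 * b 0"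
    and "i \<le> D"
  shows "i < D \<and> u i \<noteq> 0 \<and> \<alpha> / 2 * \<bar>u i\<bar> \<le> \<bar>u (Suc i)\<bar>"
  using small assms(4)
proof (induction i)
  case 0
  have "u 1 \<le> - \<alpha>"
  proof -
    have "real (b 0) * u 1 \<le> real (b 0) * (- \<alpha>)" using u_1 \<theta> by (simp add: mult.commute)
    then show ?thesis using valency_pos by (simp only: mult_le_cancel_left_pos of_nat_0_less_iff)
  qed
  then show ?case using \<alpha> D_ge_2 u_0 by simp
next
  case (Suc j)
  define k where "k = real (b 0)"
  have k: "k > 0" using valency_pos by (simp add: k_def)
  from Suc have IH: "u j \<noteq> 0" "\<alpha> / 2 * \<bar>u j\<bar> \<le> \<bar>u (Suc j)\<bar>" by simp_all
  have nz: "\<bar>u (Suc j)\<bar> > 0"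
    using mult_pos_pos[of "\<alpha> / 2" "\<bar>u j\<bar>"] IH \<alpha> by linarith
  define A B E where "A = c (Suc j) * u j" and "B = (\<theta> - a (Suc j)) * u (Suc j)"
    and "E = b (Suc j) * u (Suc (Suc j))"
  have "E = B - A"
    using u_Suc[OF Suc.prems(2)] by (simp add: A_def B_def E_def algebra_simps)
  \<comment> \<open>As \<open>\<theta>\<close> is negative and \<open>a (Suc j)\<close> is not,
    subtracting the latter cannot reduce the absolute value.\<close>
  have "\<bar>B\<bar> \<ge> \<alpha> * k * \<bar>u (Suc j)\<bar>"
    unfolding B_def abs_mult using \<theta> k_def by (intro mult_right_mono) auto
  moreover have "\<bar>A\<bar> < \<alpha> / 2 * k * \<bar>u (Suc j)\<bar>"
  proof -
    have "\<bar>A\<bar> < \<alpha>\<^sup>2 / 4 * k * \<bar>u j\<bar>"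
      unfolding A_def abs_mult k_def using Suc.prems(1)[of "Suc j"] IH(1)
      by (intro mult_strict_right_mono) auto
    also have "\<dots> = \<alpha> / 2 * k * (\<alpha> / 2 * \<bar>u j\<bar>)" by (simp add: power2_eq_square)
    also have "\<dots> \<le> \<alpha> / 2 * k * \<bar>u (Suc j)\<bar>" using IH(2) \<alpha> k by (intro mult_left_mono) auto
    finally show ?thesis .
  qed
  ultimately have E: "\<bar>E\<bar> > \<alpha> / 2 * k * \<bar>u (Suc j)\<bar>"
    using abs_triangle_ineq2[of B A] unfolding \<open>E = B - A\<close> by simp
  \<comment> \<open>At the diameter \<open>b D = 0\<close> would make \<open>E\<close> vanish,
    against its positive lower bound.\<close>
  have "Suc j \<noteq> D"
  proof
    assume "Suc j = D"
    then have "E = 0" using b_D by (simp add: E_def)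
    moreover have "\<alpha> / 2 * k * \<bar>u (Suc j)\<bar> > 0" using \<alpha> k nz by simp
    ultimately show False using E by linarith
  qed
  moreover have "\<alpha> / 2 * \<bar>u (Suc j)\<bar> \<le> \<bar>u (Suc (Suc j))\<bar>"
  proof -
    have "\<bar>E\<bar> \<le> k * \<bar>u (Suc (Suc j))\<bar>"
      unfolding E_def abs_mult k_def using b_le[OF Suc.prems(2)] by (intro mult_right_mono) auto
    then have "k * (\<alpha> / 2 * \<bar>u (Suc j)\<bar>) \<le> k * \<bar>u (Suc (Suc j))\<bar>" using E by (simp add: mult.assoc mult.left_commute)
    then show ?thesis using k by simp
  qed
  ultimately show ?case using Suc.prems(2) nz by simp
qed

lemma card_V_le_C:
  fixes \<alpha> :: real
  assumes \<alpha>: "0 < \<alpha>" "\<alpha> < 1" and \<theta>: "\<theta> \<le> - \<alpha> * b 0"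
  shows "card V \<le> (D + 1) * (4 / \<alpha>\<^sup>2) ^ (2 * D) * C"
proof -
  define e where "e = \<alpha>\<^sup>2 / 4"
  define M where "M = 4 / \<alpha>\<^sup>2"
  have "\<alpha>\<^sup>2 < 1" using \<alpha> by (simp add: power_less_one_iff)
  then have e: "e > 0" and M: "M \<ge> 1" and Me: "M * e = 1"
    using \<alpha> by (auto simp: e_def M_def field_simps)
  have e_sq: "e = (\<alpha> / 2)\<^sup>2" by (simp add: e_def power_divide)
  \<comment> \<open>\<open>c 0 = 0\<close> makes the set nonempty, and monotonicity of
    \<open>c\<close> makes \<open>t\<close> a threshold: up to the diameter, \<open>c\<close> is
    small exactly at the indices up to \<open>t\<close>.\<close>
  define t where "t = Max {i. i \<le> D \<and> c i < e * b 0}"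
  have fin: "finite {i. i \<le> D \<and> c i < e * b 0}" by simp
  have "0 \<in> {i. i \<le> D \<and> c i < e * b 0}" using e valency_pos c_0 by simp
  then have "t \<in> {i. i \<le> D \<and> c i < e * b 0}" unfolding t_def using Max_in[OF fin] by blast
  then have t: "t \<le> D" "c t < e * b 0" by simp_all
  have small: "c j < e * b 0" if "j \<le> t" for j
    using c_mono[OF that t(1)] t(2) by linarith
  have large: "c j \<ge> e * b 0" if "t < j" "j \<le> D" for j
  proof (rule ccontr)
    assume "\<not> c j \<ge> e * b 0"
    then have "j \<le> t" unfolding t_def using that by (intro Max_ge[OF fin]) simp
    then show False using that by simp
  qed
  have step: "i < D \<and> u i \<noteq> 0 \<and> \<alpha> / 2 * \<bar>u i\<bar> \<le> \<bar>u (Suc i)\<bar>" if "i \<le> t" for i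
    by (rule cosine_decay[OF \<alpha>(1) \<theta>]) (use small t that in \<open>auto simp: e_def\<close>)
  have u_ge: "(\<alpha> / 2) ^ i \<le> \<bar>u i\<bar>" if "i \<le> t" for i
    using that
  proof (induction i)
    case (Suc i)
    have "(\<alpha> / 2) ^ Suc i \<le> \<alpha> / 2 * \<bar>u i\<bar>" using Suc \<alpha> by simp
    also have "\<dots> \<le> \<bar>u (Suc i)\<bar>" using step[of i] Suc.prems by simp
    finally show ?case .
  qed (simp add: u_0)
  \<comment> \<open>The exponent \<open>D\<close> in place of \<open>i\<close> makes the bound
    uniform; since \<open>e < 1\<close>, this only weakens it.\<close>
  have u_sq: "e ^ D \<le> (u i)\<^sup>2" if "i \<le> t" for i
  proof -
    have "e ^ D \<le> e ^ i"
      using that t(1) e \<open>\<alpha>\<^sup>2 < 1\<close> by (intro power_decreasing) (auto simp: e_def)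
    also have "\<dots> = ((\<alpha> / 2) ^ i)\<^sup>2" unfolding e_sq by (simp add: power_mult[symmetric] mult.commute)
    also have "\<dots> \<le> \<bar>u i\<bar>\<^sup>2" using u_ge[OF that] \<alpha> by (intro power_mono) auto
    finally show ?thesis by simp
  qed
  \<comment> \<open>The cosines up to \<open>t\<close> are bounded away from zero, so
    \<open>C\<close> controls the total size \<open>T\<close> of these spheres.\<close>
  define T where "T = (\<Sum>i\<le>t. sphere_size i)"
  have "e ^ D * T \<le> (\<Sum>i\<le>t. sphere_size i * (u i)\<^sup>2)"
    unfolding T_def sum_distrib_left
  proof (rule sum_mono)
    fix i assume "i \<in> {..t}"
    then have i: "i \<le> t" "i \<le> D" using t by auto
    show "e ^ D * sphere_size i \<le> sphere_size i * (u i)\<^sup>2"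
      using mult_left_mono[OF u_sq[OF i(1)], of "sphere_size i"] sphere_size_pos[OF i(2)]
      by (simp add: mult.commute)
  qed
  then have eT: "e ^ D * T \<le> C" using C_ge[OF t(1)] by simp
  have TC: "T \<le> M ^ D * C"
  proof -
    have "T = M ^ D * (e ^ D * T)"
      unfolding mult.assoc[symmetric] power_mult_distrib[symmetric] Me by simp
    also have "\<dots> \<le> M ^ D * C" using eT M by (intro mult_left_mono) auto
    finally show ?thesis .
  qed
  have sT: "sphere_size j \<le> T" if "j \<le> t" for j
    unfolding T_def using that t(1)
    by (intro member_le_sum) (auto intro!: less_imp_le[OF sphere_size_pos])
  have "T \<ge> 0" using sT[of 0] by simp
  \<comment> \<open>Past \<open>t\<close>, the quotient \<open>b j / c (Suc j)\<close> of successive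
    sphere sizes is at most \<open>b 0 / (e * b 0) = M\<close>.\<close>
  have grow: "sphere_size j \<le> M ^ (j - t) * T" if "t \<le> j" "j \<le> D" for j
    using that
  proof (induction j rule: dec_induct)
    case base
    then show ?case using sT[of t] by simp
  next
    case (step j)
    have c: "c (Suc j) > 0" "b j \<le> M * c (Suc j)"
    proof -
      show "c (Suc j) > 0" using c_pos step.prems by simp
      have "real (b j) \<le> M * (e * b 0)"
        unfolding mult.assoc[symmetric] Me using b_le[of j] step.prems by simp
      also have "\<dots> \<le> M * c (Suc j)" using large[of "Suc j"] step M by (intro mult_left_mono) auto
      finally show "b j \<le> M * c (Suc j)" .
    qed
    have "sphere_size (Suc j) = sphere_size j * (b j / c (Suc j))" by simp
    also have "\<dots> \<le> sphere_size j * M"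
      using c sphere_size_pos[of j] step.prems by (intro mult_left_mono) (auto simp: field_simps)
    also have "\<dots> \<le> M ^ (j - t) * T * M" using step M by (intro mult_right_mono) auto
    also have "\<dots> = M ^ (Suc j - t) * T" using step.hyps by (simp add: Suc_diff_le)
    finally show ?case .
  qed
  have "sphere_size j \<le> M ^ D * T" if "j \<le> D" for j
  proof (cases "j \<le> t")
    case True
    have "1 * T \<le> M ^ D * T" using M \<open>T \<ge> 0\<close> by (intro mult_right_mono) auto
    then show ?thesis using sT[OF True] by simp
  next
    case False
    then have "sphere_size j \<le> M ^ (j - t) * T" using grow that by simp
    also have "\<dots> \<le> M ^ D * T" using M \<open>T \<ge> 0\<close> that by (intro mult_right_mono power_increasing) auto
    finally show ?thesis .
  qed
  \<comment> \<open>There are \<open>D + 1\<close> spheres; one factor \<open>M ^ D\<close> compares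
    each of them with \<open>T\<close>, a second one compares \<open>T\<close> with
    \<open>C\<close>.\<close>
  then have "real (card V) \<le> (\<Sum>j\<le>D. M ^ D * T)"
    unfolding card_V by (intro sum_mono) simp
  also have "\<dots> = real (D + 1) * M ^ D * T" by simp
  also have "\<dots> \<le> real (D + 1) * M ^ D * (M ^ D * C)"
    using TC M by (intro mult_left_mono) auto
  also have "\<dots> = real (D + 1) * M ^ (2 * D) * C"
    by (simp add: mult_2 power_add mult.assoc)
  finally show ?thesis by (simp add: M_def)
qed

section \<open>The excluded cases \<open>u 1 = - 1\<close> and \<open>u 2 = 1\<close>\<close>

lemma bipartition_if_u_1:
  assumes "u 1 = - 1"
  shows "\<exists>A B. A \<union> B = V \<and> A \<inter> B = {} \<and> (\<forall>x y. adj x y \<longrightarrow> x \<in> A \<and> y \<in> B \<or> x \<in> B \<and> y \<in> A)"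
proof -
  obtain x0 where x0: "x0 \<in> V" using d_attained by blast
  \<comment> \<open>Adjacent vertices have opposite rows, so the cosine to \<open>x0\<close> changes
    sign along every edge. Starting from the value 1 at \<open>x0\<close>, it takes only the values
    1 and -1, and its sign is a 2-colouring.\<close>
  have flip: "u (d x x0) = - u (d y x0)" if "adj x y" for x y
  proof -
    have V: "x \<in> V" "y \<in> V" using adj_V[OF that] by simp_all
    have "u (d x y) = - 1" using adj_iff[OF V] that assms by simp
    from proportional_rows[OF V _ this x0] show ?thesis by simp
  qed
  have pm: "u (d x x0) = 1 \<or> u (d x x0) = - 1" if "x \<in> V" "d x0 x = n" for x n
    using that
  proof (induction n arbitrary: x)
    case 0
    then show ?case using d_sym[OF x0] u_0 by simp
  next
    case (Suc n)
    then obtain z where z: "adj z x" "d x0 z = n" using d_pred[OF x0] by blast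
    then show ?case using Suc.IH[of z] flip[OF z(1)] adj_V[OF z(1)] by auto
  qed
  show ?thesis
  proof (rule exI[of _ "{x \<in> V. u (d x x0) = 1}"], rule exI[of _ "{x \<in> V. u (d x x0) = - 1}"],
      intro conjI allI impI)
    show "{x \<in> V. u (d x x0) = 1} \<union> {x \<in> V. u (d x x0) = - 1} = V" using pm by blast
    show "{x \<in> V. u (d x x0) = 1} \<inter> {x \<in> V. u (d x x0) = - 1} = {}" by auto
    fix x y assume xy: "adj x y"
    show "x \<in> {x \<in> V. u (d x x0) = 1} \<and> y \<in> {x \<in> V. u (d x x0) = - 1} \<or>
      x \<in> {x \<in> V. u (d x x0) = - 1} \<and> y \<in> {x \<in> V. u (d x x0) = 1}"
      using pm[of x] adj_V[OF xy] flip[OF xy] by auto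
  qed
qed

text \<open>By \<open>proportional_rows\<close>, vertices at distance 2 have equal rows. Together
  with the existence of triangles this excludes distance 3, so nonadjacent vertices are equal or at
  distance 2.\<close>

lemma nonadjacent_cosine:
  assumes "u 2 = 1" "u 1 \<noteq> 1" "u 1 \<noteq> - 1" and xy: "x \<in> V" "y \<in> V" "\<not> adj x y"
  shows "u (d x y) = 1"
proof -
  \<comment> \<open>Without triangles the recurrence at index 1 reads
    \<open>1 + b 1 = \<theta> * u 1\<close>, where \<open>1 + b 1 = b 0\<close> and
    \<open>\<theta> = b 0 * u 1\<close>; this forces \<open>(u 1)\<^sup>2 = 1\<close>.\<close>
  have a1: "a 1 > 0"
  proof (rule ccontr)
    assume "\<not> a 1 > 0"
    then have "a 1 = 0" by simp
    then have "1 + real (b 1) = \<theta> * u 1" "1 + real (b 1) = b 0"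
      using u_Suc[of 0] abc_sum[of 1] D_ge_2 c_1 u_0 assms(1) by (simp_all add: numeral_2_eq_2)
    then have "real (b 0) = b 0 * u 1 * u 1" unfolding u_1 by simp
    then have "real (b 0) = b 0 * (u 1)\<^sup>2" by (simp add: power2_eq_square)
    then have "(u 1)\<^sup>2 = 1" using valency_pos by simp
    then show False using assms by (simp add: power2_eq_1_iff)
  qed
  have same: "u (d x z) = u (d y z)" if "x \<in> V" "y \<in> V" "d x y = 2" "z \<in> V" for x y z
    using proportional_rows[of x y 1 z] that assms(1) by simp
  have no3: "d x y \<noteq> 3" if xy: "x \<in> V" "y \<in> V" for x y
  proof
    assume d3: "d x y = 3"
    then obtain x2 where x2: "adj x2 y" "d x x2 = 2"
      using d_pred[OF xy, of 2] by auto
    have V2: "x2 \<in> V" using adj_V[OF x2(1)] by simp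
    obtain x1 where x1: "adj x1 x2" "d x x1 = 1"
      using d_pred[OF xy(1) V2, of 1] x2(2) by auto
    have V1: "x1 \<in> V" using adj_V[OF x1(1)] by simp
    have d12: "d x1 x2 = 1" using adj_iff[OF V1 V2] x1 by simp
    \<comment> \<open>On the geodesic \<open>x\<close>, \<open>x1\<close>, \<open>x2\<close>,
      \<open>y\<close>, the edge between \<open>x1\<close> and \<open>x2\<close> lies in a triangle
      with apex \<open>w\<close>.\<close>
    have "card {z. adj x2 z \<and> d x1 z = 1} > 0"
      using card_nbrs_dist[OF V1 V2, of 1] d12 a1 by (simp add: p_def)
    then obtain w where w: "adj x2 w" "d x1 w = 1" by (auto simp: card_gt_0_iff)
    have W: "w \<in> V" using adj_V[OF w(1)] by simp
    have w1: "adj x1 w" using adj_iff[OF V1 W] w by simp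
    have dw2: "d w x2 = 1" using adj_iff[OF V2 W] w(1) d_sym[OF V2 W] by simp
    \<comment> \<open>At distance 2, \<open>x\<close> and \<open>w\<close> would have rows agreeing
      at \<open>x2\<close>, where their entries are \<open>u 2\<close> and
      \<open>u 1\<close>.\<close>
    have dxw: "d x w = 1"
    proof -
      have "d x w \<le> 2" using d_step[OF w1 xy(1)] x1(2) by simp
      moreover have "d x w \<noteq> 0"
      proof
        assume "d x w = 0"
        then have "x = w" by (rule d_0[OF xy(1) W])
        then show False using dw2 x2(2) by simp
      qed
      moreover have "d x w \<noteq> 2"
        using same[OF xy(1) W _ V2] dw2 x2(2) assms(1,2) by auto
      ultimately show ?thesis by linarith
    qed
    have "d x1 y = 2"
    proof -
      have "d y x = 3" "d y x1 = d x1 y" "d x x1 = 1" using d3 d_sym[OF xy] d_sym[OF V1 xy(2)] x1 by simp_all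
      moreover have "adj x1 x" using adj_iff[OF V1 xy(1)] x1(2) d_sym[OF V1 xy(1)] by simp
      ultimately have "d x1 y \<ge> 2" using d_step[of x1 x y] xy(2) by simp
      moreover have "d x1 y \<le> 2" using d_step[OF x2(1) V1] d12 by simp
      ultimately show ?thesis by simp
    qed
    \<comment> \<open>The rows of \<open>x1\<close> and \<open>y\<close> agree at \<open>w\<close>,
      but their entries there are \<open>u 1\<close> and \<open>u 2 = 1\<close>.\<close>
    then have "u (d x1 w) = u (d y w)" using same[OF V1 xy(2) _ W] by simp
    moreover have "d y w = 2"
    proof -
      have "d w y \<le> 2" using d_step[OF x2(1) W] dw2 by simp
      moreover have "d w y \<noteq> 0"
      proof
        assume "d w y = 0"
        then have "w = y" by (rule d_0[OF W xy(2)])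
        then show False using dxw d3 by simp
      qed
      moreover have "d w y \<noteq> 1" using d_step[of w y x] adj_iff[OF W xy(2)] xy(1) dxw d3 by auto
      ultimately show ?thesis using d_sym[OF W xy(2)] by linarith
    qed
    ultimately show False using w(2) assms(1,2) by simp
  qed
  have "D < 3"
  proof (rule ccontr)
    assume "\<not> D < 3"
    then show False using dist_exists[of 3] no3 by auto
  qed
  then have "d x y \<le> 2" using d_le[OF xy(1,2)] by simp
  moreover have "d x y \<noteq> 1" using adj_iff[OF xy(1,2)] xy(3) by simp
  ultimately have "d x y = 0 \<or> d x y = 2" by linarith
  then show ?thesis using assms(1) u_0 by metis
qed

text \<open>If \<open>u 2 = 1\<close>, nonadjacent vertices have equal rows, so the rows agree along
  paths of the complement. Coconnectedness then equates the rows of two adjacent vertices, giving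
  \<open>u 1 = u 0\<close>.\<close>

lemma u_2_neq_1:
  assumes "u 1 \<noteq> 1" "u 1 \<noteq> - 1"
    and coconn: "\<And>x y. x \<in> V \<Longrightarrow> y \<in> V \<Longrightarrow>
      (x, y) \<in> {(v, w). v \<in> V \<and> w \<in> V \<and> v \<noteq> w \<and> \<not> adj v w}\<^sup>*"
  shows "u 2 \<noteq> 1"
proof
  assume u2: "u 2 = 1"
  obtain x y where xy: "x \<in> V" "y \<in> V" "d x y = 1" using dist_exists[of 1] D_ge_2 by auto
  have "u (d y x) = 1"
    using coconn[OF xy(1,2)]
  proof (induction rule: rtrancl_induct)
    case base
    then show ?case using d_refl[OF xy(1)] u_0 by simp
  next
    case (step v w)
    then have vw: "v \<in> V" "w \<in> V" "\<not> adj v w" by auto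
    have "u (d v w) = 1" by (rule nonadjacent_cosine[OF u2 assms(1,2) vw])
    then have "u (d v x) = u (d w x)" using proportional_rows[OF vw(1,2) _ _ xy(1), of 1] by simp
    then show ?case using step.IH by simp
  qed
  then show False using assms(1) xy(3) d_sym[OF xy(1,2)] by simp
qed

lemma valency_le:
  fixes \<alpha> :: real
  assumes \<alpha>: "0 < \<alpha>" "\<alpha> < 1" and \<theta>: "\<theta> \<le> - \<alpha> * b 0"
    and coconn: "\<And>x y. x \<in> V \<Longrightarrow> y \<in> V \<Longrightarrow>
      (x, y) \<in> {(v, w). v \<in> V \<and> w \<in> V \<and> v \<noteq> w \<and> \<not> adj v w}\<^sup>*"
    and nonbip: "\<not> (\<exists>A B. A \<union> B = V \<and> A \<inter> B = {} \<and>
      (\<forall>x y. adj x y \<longrightarrow> x \<in> A \<and> y \<in> B \<or> x \<in> B \<and> y \<in> A))"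
  shows "b 0 \<le> (nat \<lceil>(D + 1) * (4 / \<alpha>\<^sup>2) ^ (2 * D)\<rceil> + 1)\<^sup>2"
proof -
  have "real (b 0) * u 1 < 0" using u_1 \<theta> \<alpha> valency_pos by (simp add: mult_pos_pos order.strict_trans1)
  then have u1: "u 1 \<noteq> 1" using valency_pos by auto
  have u1': "u 1 \<noteq> - 1" using bipartition_if_u_1 nonbip by blast
  have u2: "u 2 \<noteq> 1" by (rule u_2_neq_1[OF u1 u1' coconn])
  have "real (card V) \<le> (D + 1) * (4 / \<alpha>\<^sup>2) ^ (2 * D) * C" by (rule card_V_le_C[OF \<alpha> \<theta>])
  also have "\<dots> \<le> real (nat \<lceil>(D + 1) * (4 / \<alpha>\<^sup>2) ^ (2 * D)\<rceil>) * C"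
    using C_pos by (intro mult_right_mono real_nat_ceiling_ge) auto
  finally show ?thesis by (rule valency_le_if_small_rank[OF u1 u2])
qed

end

section \<open>Distance-regular graphs and their adjacency matrices\<close>

text \<open>\<open>graph_connected\<close> refers to the symmetric closure of the arcs, which adds
  nothing to a symmetric arc set. In this form the lemma serves both the graph and its
  complement.\<close>

lemma graph_connected_rtrancl:
  assumes "graph_connected G" and sym: "\<And>u v. (u, v) \<in> parcs G \<Longrightarrow> (v, u) \<in> parcs G"
    and "u \<in> pverts G" "v \<in> pverts G"
  shows "(u, v) \<in> (parcs G)\<^sup>*"
proof -
  have "(u, v) \<in> rtrancl_on (pverts G) (parcs (mk_symmetric (with_proj G)))"
    using assms(1,3,4)
    unfolding graph_connected_def connected_def strongly_connected_def reachable_def by simp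
  then have "(u, v) \<in> (parcs (mk_symmetric (with_proj G)))\<^sup>*"
    by (rule rtrancl_on_rtranclI)
  moreover have "parcs (mk_symmetric (with_proj G)) \<subseteq> parcs G"
    using sym by (auto simp: parcs_mk_symmetric)
  ultimately show ?thesis using rtrancl_mono by blast
qed

section \<open>Walks and the graph metric\<close>

context pair_graph
begin

lemma awalk_snoc:
  assumes "awalk u q v" "(v, w) \<in> parcs G"
  shows "awalk u (q @ [(v, w)]) w"
  using assms by (auto simp: awalk_Cons_iff awalk_Nil_iff intro: in_arcsD2)

lemma graph_dist_le: "awalk u q v \<Longrightarrow> graph_dist G u v \<le> length q"
  unfolding graph_dist_def by (rule Least_le) blast

lemma awalk_exists:
  assumes "graph_connected G" "u \<in> pverts G" "v \<in> pverts G"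
  shows "\<exists>q. awalk u q v"
proof -
  have "(u, v) \<in> (parcs G)\<^sup>*"
    using graph_connected_rtrancl[OF assms(1) _ assms(2,3)] arcs_symmetric by blast
  then show ?thesis
  proof (induction rule: rtrancl_induct)
    case base
    then show ?case using assms(2) awalk_Nil_iff by blast
  next
    case (step y z)
    then show ?case using awalk_snoc by blast
  qed
qed

lemma shortest_awalk:
  assumes "graph_connected G" "u \<in> pverts G" "v \<in> pverts G"
  obtains q where "awalk u q v" "length q = graph_dist G u v"
proof -
  have "\<exists>n q. awalk u q v \<and> length q = n" using awalk_exists[OF assms] by blast
  from LeastI_ex[OF this] show ?thesis using that unfolding graph_dist_def by blast
qed

lemma graph_dist_refl: "u \<in> pverts G \<Longrightarrow> graph_dist G u u = 0"
  using graph_dist_le[of u "[]" u] by (simp add: awalk_Nil_iff)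

lemma graph_dist_0:
  assumes "graph_connected G" "u \<in> pverts G" "v \<in> pverts G" "graph_dist G u v = 0"
  shows "u = v"
proof -
  obtain q where "awalk u q v" "length q = graph_dist G u v" using shortest_awalk[OF assms(1-3)] .
  then have "awalk u [] v" using assms(4) by simp
  then show ?thesis by (simp add: awalk_Nil_iff)
qed

lemma graph_dist_sym_le:
  assumes "graph_connected G" "u \<in> pverts G" "v \<in> pverts G"
  shows "graph_dist G v u \<le> graph_dist G u v"
proof -
  obtain q where q: "awalk u q v" "length q = graph_dist G u v" using shortest_awalk[OF assms] .
  have "length (rev_path q) = length q" by (induction q) simp_all
  moreover have "awalk v (rev_path q) u" using q(1) by simp
  ultimately show ?thesis using graph_dist_le[of v "rev_path q" u] q(2) by simp
qed

lemma graph_dist_step: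
  assumes "graph_connected G" "(u, v) \<in> parcs G" "w \<in> pverts G"
  shows "graph_dist G w v \<le> Suc (graph_dist G w u)"
proof -
  obtain q where q: "awalk w q u" "length q = graph_dist G w u"
    using shortest_awalk[OF assms(1,3) in_arcsD1[OF assms(2)]] .
  show ?thesis using graph_dist_le[OF awalk_snoc[OF q(1) assms(2)]] q(2) by simp
qed

text \<open>Removing the last arc of a shortest walk leaves a walk of length \<open>i\<close>; if
  its endpoint were closer to \<open>u\<close>, then \<open>v\<close> would be too close by
  \<open>graph_dist_step\<close>.\<close>

lemma graph_dist_pred:
  assumes "graph_connected G" "u \<in> pverts G" "v \<in> pverts G" "graph_dist G u v = Suc i"
  shows "\<exists>w. (w, v) \<in> parcs G \<and> graph_dist G u w = i"
proof -
  obtain q where q: "awalk u q v" "length q = graph_dist G u v"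
    using shortest_awalk[OF assms(1-3)] .
  then obtain e r where re: "q = r @ [e]" "length r = i"
    using assms(4) length_Suc_conv_rev[of q i] by auto
  then have e: "awalk u r (fst e)" "e \<in> parcs G" "snd e = v"
    using q(1) by (auto simp: awalk_Cons_iff awalk_Nil_iff)
  have "graph_dist G u (fst e) \<le> i" using graph_dist_le[OF e(1)] re(2) by simp
  moreover have "(fst e, v) \<in> parcs G" using e(2) unfolding e(3)[symmetric] by simp
  moreover from graph_dist_step[OF assms(1) this assms(2)] have "Suc i \<le> Suc (graph_dist G u (fst e))"
    using assms(4) by simp
  ultimately show ?thesis by (intro exI[of _ "fst e"]) simp
qed

lemma drg_intersection_numbers:
  assumes conn: "graph_connected G" and ne: "pverts G \<noteq> {}" and ibc: "intersection_numbers G b c"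
  shows "drg (pverts G) (\<lambda>x y. (x, y) \<in> parcs G) (graph_dist G) (graph_diameter G) b c"
proof -
  let ?S = "{graph_dist G u v | u v. u \<in> pverts G \<and> v \<in> pverts G}"
  have fin: "finite ?S" using pair_finite_verts by (intro finite_image_set2) simp_all
  have "?S \<noteq> {}" using ne by blast
  \<comment> \<open>Being attained, the maximum yields \<open>d_attained\<close>; as an upper bound,
    it keeps all distances within the range covered by \<open>intersection_numbers\<close>.\<close>
  then have "graph_diameter G \<in> ?S" unfolding graph_diameter_def by (rule Max_in[OF fin])
  then obtain u v where uv: "graph_diameter G = graph_dist G u v" "u \<in> pverts G" "v \<in> pverts G"
    by blast
  have att: "\<exists>x\<in>pverts G. \<exists>y\<in>pverts G. graph_dist G x y = graph_diameter G"
    by (intro bexI[of _ u] bexI[of _ v]) (simp_all add: uv)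
  have le: "graph_dist G x y \<le> graph_diameter G" if "x \<in> pverts G" "y \<in> pverts G" for x y
    unfolding graph_diameter_def by (rule Max_ge[OF fin]) (use that in blast)
  show ?thesis
  proof (unfold_locales, goal_cases)
    case 1 show ?case by (rule pair_finite_verts)
  next
    case (2 x y) then show ?case by (simp add: in_arcsD1 in_arcsD2)
  next
    case (3 x y) then show ?case by (rule arcs_symmetric)
  next
    case (4 x) show ?case using no_loops'[of x x] by blast
  next
    case (5 x) then show ?case by (rule graph_dist_refl)
  next
    case (6 x y) then show ?case by (rule graph_dist_0[OF conn])
  next
    case (7 x y) then show ?case using graph_dist_sym_le[OF conn] by (simp add: le_antisym)
  next
    case (8 x y z) then show ?case by (rule graph_dist_step[OF conn])
  next
    case (9 x y i) then show ?case by (rule graph_dist_pred[OF conn])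
  next
    case (10 x y) then show ?case by (rule le)
  next
    case 11 show ?case by (rule att)
  next
    case (12 x y) then show ?case using ibc le[OF 12] by (simp add: intersection_numbers_def)
  next
    case (13 x y) then show ?case using ibc le[OF 13] by (simp add: intersection_numbers_def)
  qed
qed

end

section \<open>The adjacency matrix and its eigenvalues\<close>

lemma vertex_list:
  assumes "finite (pverts G)"
  shows "distinct (vertex_list G)" "set (vertex_list G) = pverts G"
proof -
  have "\<exists>vs. distinct vs \<and> set vs = pverts G" using finite_distinct_list[OF assms] by blast
  from someI_ex[OF this, folded vertex_list_def]
  show "distinct (vertex_list G)" "set (vertex_list G) = pverts G" by simp_all
qed

lemma adjacency_mat_mult:
  assumes fin: "finite (pverts G)" and wf: "parcs G \<subseteq> pverts G \<times> pverts G"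
    and v: "v \<in> carrier_vec (length (vertex_list G))"
    and f: "\<And>i. i < length (vertex_list G) \<Longrightarrow> f (vertex_list G ! i) = v $ i"
    and i: "i < length (vertex_list G)"
  shows "(adjacency_mat G *\<^sub>v v) $ i = (\<Sum>y | (vertex_list G ! i, y) \<in> parcs G. f y)"
proof -
  define vs n where "vs = vertex_list G" and "n = length vs"
  note vs = vertex_list[OF fin, folded vs_def]
  have bij: "bij_betw ((!) vs) {..<n} (pverts G)"
    using bij_betw_nth[OF vs(1)] vs(2) by (simp add: n_def)
  have "(adjacency_mat G *\<^sub>v v) $ i
    = (\<Sum>j<n. (if (vs ! i, vs ! j) \<in> parcs G then f (vs ! j) else 0))"
  proof -
    have A: "adjacency_mat G = mat n n (\<lambda>(i, j). if (vs ! i, vs ! j) \<in> parcs G then 1 else 0)"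
      by (simp add: adjacency_mat_def Let_def vs_def n_def)
    have dim: "dim_vec v = n" and i': "i < n" using v i by (simp_all add: vs_def n_def)
    have f': "f (vs ! j) = v $ j" if "j < n" for j using that f by (simp add: vs_def n_def)
    have "(adjacency_mat G *\<^sub>v v) $ i = (\<Sum>j<n. adjacency_mat G $$ (i, j) * v $ j)"
      using i' by (simp add: A scalar_prod_def dim lessThan_atLeast0)
    also have "\<dots> = (\<Sum>j<n. (if (vs ! i, vs ! j) \<in> parcs G then f (vs ! j) else 0))"
      by (rule sum.cong) (use i' f' in \<open>simp_all add: A\<close>)
    finally show ?thesis .
  qed
  also have "\<dots> = (\<Sum>y\<in>pverts G. if (vs ! i, y) \<in> parcs G then f y else 0)"
    by (rule sum.reindex_bij_betw[OF bij, of "\<lambda>y. if (vs ! i, y) \<in> parcs G then f y else 0"])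
  also have "\<dots> = (\<Sum>y | y \<in> pverts G \<and> (vs ! i, y) \<in> parcs G. f y)"
    using fin by (rule sum.inter_filter[symmetric])
  also have "{y. y \<in> pverts G \<and> (vs ! i, y) \<in> parcs G} = {y. (vs ! i, y) \<in> parcs G}"
    using wf by blast
  finally show ?thesis by (simp add: vs_def)
qed

text \<open>Removes the arbitrary enumeration of the vertices: vectors indexed by positions
  correspond to functions on the vertices, as used in \<open>eigen\<close>.\<close>

lemma eigenvalue_adjacency_mat_iff:
  assumes fin: "finite (pverts G)" and wf: "parcs G \<subseteq> pverts G \<times> pverts G"
  shows "eigenvalue (adjacency_mat G) \<theta> \<longleftrightarrow>
    (\<exists>f. (\<exists>x\<in>pverts G. f x \<noteq> 0) \<and> (\<forall>x\<in>pverts G. (\<Sum>y | (x, y) \<in> parcs G. f y) = \<theta> * f x))"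
    (is "_ \<longleftrightarrow> ?R")
proof -
  define vs n where "vs = vertex_list G" and "n = length vs"
  note vs = vertex_list[OF fin, folded vs_def]
  have dim: "dim_row (adjacency_mat G) = n" "dim_col (adjacency_mat G) = n"
    by (simp_all add: adjacency_mat_def Let_def vs_def n_def)
  note mult = adjacency_mat_mult[OF fin wf, folded vs_def, folded n_def]
  have nth: "\<exists>i<n. x = vs ! i" if "x \<in> pverts G" for x
    using that in_set_conv_nth[of x vs] unfolding vs(2) n_def by auto
  have nth_V: "vs ! i \<in> pverts G" if "i < n" for i
    using that nth_mem[of i vs] unfolding vs(2) n_def by blast
  show ?thesis
  proof
    assume "eigenvalue (adjacency_mat G) \<theta>"
    then obtain v where v: "v \<in> carrier_vec n" "v \<noteq> 0\<^sub>v n"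
      "adjacency_mat G *\<^sub>v v = \<theta> \<cdot>\<^sub>v v"
      unfolding eigenvalue_def eigenvector_def dim by blast
    define f where "f x = v $ (the_inv_into {..<n} ((!) vs) x)" for x
    have f: "f (vs ! i) = v $ i" if "i < n" for i
      using that vs(1) by (simp add: f_def the_inv_into_f_f inj_on_nth n_def)
    have "\<exists>i<n. v $ i \<noteq> 0"
    proof (rule ccontr)
      assume "\<not> (\<exists>i<n. v $ i \<noteq> 0)"
      then have "v = 0\<^sub>v n" using v(1) by (intro eq_vecI) auto
      then show False using v(2) by blast
    qed
    then obtain i where i: "i < n" "v $ i \<noteq> 0" by blast
    then have "\<exists>x\<in>pverts G. f x \<noteq> 0"
      using f[OF i(1)] nth_V[OF i(1)] by (intro bexI[of _ "vs ! i"]) simp_all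
    moreover have "(\<Sum>y | (x, y) \<in> parcs G. f y) = \<theta> * f x" if x: "x \<in> pverts G" for x
    proof -
      obtain i where i: "i < n" "x = vs ! i" using nth[OF x] by blast
      have "(\<Sum>y | (vs ! i, y) \<in> parcs G. f y) = (adjacency_mat G *\<^sub>v v) $ i"
        using mult[OF v(1) f i(1)] by simp
      also have "\<dots> = \<theta> * f (vs ! i)" using v(1,3) i(1) f by simp
      finally show ?thesis by (simp add: i(2))
    qed
    ultimately show ?R by blast
  next
    assume ?R
    then obtain f x where x: "x \<in> pverts G" "f x \<noteq> 0"
      and f: "\<And>x. x \<in> pverts G \<Longrightarrow> (\<Sum>y | (x, y) \<in> parcs G. f y) = \<theta> * f x" by blast
    define v where "v = vec n (\<lambda>i. f (vs ! i))"
    have v: "v \<in> carrier_vec n" by (simp add: v_def)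
    have fv: "f (vs ! i) = v $ i" if "i < n" for i using that by (simp add: v_def)
    have "adjacency_mat G *\<^sub>v v = \<theta> \<cdot>\<^sub>v v"
    proof (rule eq_vecI)
      fix i assume "i < dim_vec (\<theta> \<cdot>\<^sub>v v)"
      then have i: "i < n" by (simp add: v_def)
      have "(adjacency_mat G *\<^sub>v v) $ i = (\<Sum>y | (vs ! i, y) \<in> parcs G. f y)"
        using mult[OF v fv i] by simp
      then show "(adjacency_mat G *\<^sub>v v) $ i = (\<theta> \<cdot>\<^sub>v v) $ i"
        using f[OF nth_V[OF i]] fv[OF i] i carrier_vecD[OF v] by simp
    qed (simp add: dim v_def)
    moreover have "v \<noteq> 0\<^sub>v n"
    proof -
      obtain i where i: "i < n" "x = vs ! i" using nth[OF x(1)] by blast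
      then have "v $ i \<noteq> 0" using x(2) fv[OF i(1)] by simp
      then show ?thesis using i(1) by auto
    qed
    ultimately show "eigenvalue (adjacency_mat G) \<theta>"
      unfolding eigenvalue_def eigenvector_def dim using v by blast
  qed
qed

text \<open>The constant function shows that the real spectrum is nonempty, so that its minimum is
  attained.\<close>

lemma (in drg) smallest_eigenvalue_eigenvalue:
  assumes "pverts G = V" and "\<And>x y. adj x y \<longleftrightarrow> (x, y) \<in> parcs G"
  shows "eigenvalue (adjacency_mat G) (smallest_eigenvalue G)"
proof -
  have fin: "finite (pverts G)" and wf: "parcs G \<subseteq> pverts G \<times> pverts G"
    using finite_V adj_V assms by auto
  obtain x where "x \<in> V" using d_attained by blast
  moreover have "(\<Sum>y | (x, y) \<in> parcs G. 1) = real (b 0) * 1" if "x \<in> pverts G" for x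
    using degree[of x] that assms by simp
  ultimately have "eigenvalue (adjacency_mat G) (real (b 0))"
    using assms(1)
    by (intro iffD2[OF eigenvalue_adjacency_mat_iff[OF fin wf]] exI[of _ "\<lambda>_. 1"]) auto
  moreover have "adjacency_mat G \<in> carrier_mat (length (vertex_list G)) (length (vertex_list G))"
    by (simp add: adjacency_mat_def Let_def)
  ultimately have "Min (spectrum (adjacency_mat G)) \<in> spectrum (adjacency_mat G)"
    by (intro Min_in card_finite_spectrum(1)) (auto simp: spectrum_def)
  then show ?thesis by (simp add: smallest_eigenvalue_def spectrum_def)
qed

section \<open>Finiteness up to isomorphism\<close>

lemma finitely_many_graphs:
  "\<exists>R :: nat pair_pre_digraph set. finite R \<and>
    (\<forall>G :: 'a pair_pre_digraph. pair_graph G \<and> card (pverts G) \<le> N \<longrightarrow> (\<exists>H\<in>R. graph_iso G H))"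
proof (intro exI conjI allI impI)
  \<comment> \<open>Relabelling moves a graph onto an initial segment of the natural numbers. Some
    records in this set are not graphs, which does no harm to its finiteness.\<close>
  let ?R = "(\<lambda>(n, E). \<lparr>pverts = {0..<n}, parcs = E\<rparr>) ` ({..N} \<times> Pow ({0..<N} \<times> {0..<N}))
    :: nat pair_pre_digraph set"
  show "finite ?R" by simp
  fix G :: "'a pair_pre_digraph"
  assume G: "pair_graph G \<and> card (pverts G) \<le> N"
  then interpret pair_graph G by simp
  define n where "n = card (pverts G)"
  obtain h where h: "bij_betw h (pverts G) {0..<n}"
    using ex_bij_betw_finite_nat[OF pair_finite_verts] by (auto simp: n_def)
  have hn: "h x < n" if "x \<in> pverts G" for x using h that by (auto simp: bij_betw_def)
  have inj: "h x = h y \<longleftrightarrow> x = y" if "x \<in> pverts G" "y \<in> pverts G" for x y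
    using h that by (auto simp: bij_betw_def inj_on_def)
  define H where "H = \<lparr>pverts = {0..<n}, parcs = (\<lambda>(x, y). (h x, h y)) ` parcs G\<rparr>"
  have sub: "parcs H \<subseteq> {0..<n} \<times> {0..<n}"
    using hn in_arcsD1 in_arcsD2 by (auto simp: H_def)
  have "pair_graph H"
  proof
    show "finite (parcs H)" using pair_finite_arcs by (simp add: H_def)
    show "symmetric (with_proj H)"
      using arcs_symmetric by (force simp: symmetric_def sym_def H_def)
    show "fst e \<noteq> snd e" if "e \<in> parcs H" for e
      using that inj in_arcsD1 in_arcsD2 no_loops' by (force simp: H_def)
  qed (use sub in \<open>auto simp: H_def\<close>)
  moreover have "(u, v) \<in> parcs G \<longleftrightarrow> (h u, h v) \<in> parcs H" if "u \<in> pverts G" "v \<in> pverts G" for u v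
    using that inj in_arcsD1 in_arcsD2 by (force simp: H_def)
  ultimately have "graph_iso G H"
    using h G by (subst graph_iso_iff) (auto simp: H_def intro!: exI[of _ h])
  moreover have "H \<in> ?R"
  proof (rule image_eqI[of _ _ "(n, parcs H)"])
    show "(n, parcs H) \<in> {..N} \<times> Pow ({0..<N} \<times> {0..<N})"
      using sub G by (force simp: n_def)
  qed (simp add: H_def)
  ultimately show "\<exists>H\<in>?R. graph_iso G H" by blast
qed

theorem theorem1p1:
  fixes \<alpha> :: real and D :: nat
  assumes "0 < \<alpha>" and "\<alpha> < 1" and "D \<ge> 2"
  shows "\<exists>R :: nat pair_pre_digraph set. finite R \<and>
    (\<forall>\<Gamma> :: 'a pair_pre_digraph.
       distance_regular \<Gamma> \<and> coconnected \<Gamma> \<and> \<not> bipartite \<Gamma> \<and>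
       valency \<Gamma> \<ge> 2 \<and> graph_diameter \<Gamma> = D \<and>
       smallest_eigenvalue \<Gamma> \<le> - \<alpha> * real (valency \<Gamma>)
       \<longrightarrow> (\<exists>\<Delta> \<in> R. graph_iso \<Gamma> \<Delta>))"
proof -
  \<comment> \<open>\<open>K\<close> depends on \<open>\<alpha>\<close> and \<open>D\<close> alone,
    so \<open>R\<close> can be fixed before the graph.\<close>
  define K where "K = (nat \<lceil>(D + 1) * (4 / \<alpha>\<^sup>2) ^ (2 * D)\<rceil> + 1)\<^sup>2"
  obtain R :: "nat pair_pre_digraph set" where "finite R"
    and R: "\<And>G :: 'a pair_pre_digraph. pair_graph G \<Longrightarrow> card (pverts G) \<le> (\<Sum>i\<le>D. K ^ i)
      \<Longrightarrow> \<exists>H\<in>R. graph_iso G H"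
    using finitely_many_graphs[where ?'a = 'a] by meson
  have "\<exists>\<Delta>\<in>R. graph_iso \<Gamma> \<Delta>"
    if dr: "distance_regular \<Gamma>" and co: "coconnected \<Gamma>" and nonbip: "\<not> bipartite \<Gamma>"
      and diam: "graph_diameter \<Gamma> = D"
      and small: "smallest_eigenvalue \<Gamma> \<le> - \<alpha> * real (valency \<Gamma>)" for \<Gamma> :: "'a pair_pre_digraph"
  proof -
    from dr obtain b c where G: "pair_graph \<Gamma>" and conn: "graph_connected \<Gamma>"
      and ibc: "intersection_numbers \<Gamma> b c"
      unfolding distance_regular_def by blast
    interpret G: pair_graph \<Gamma> by (rule G)
    have ne: "pverts \<Gamma> \<noteq> {}"
      using conn unfolding graph_connected_def connected_def strongly_connected_def by simp
    interpret drg "pverts \<Gamma>" "\<lambda>x y. (x, y) \<in> parcs \<Gamma>" "graph_dist \<Gamma>" D b c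
      using G.drg_intersection_numbers[OF conn ne ibc] unfolding diam .
    have \<theta>: "smallest_eigenvalue \<Gamma> \<le> - \<alpha> * b 0" using small valency_eq[OF ne ibc] by simp
    have ev: "eigenvalue (adjacency_mat \<Gamma>) (smallest_eigenvalue \<Gamma>)"
      by (rule smallest_eigenvalue_eigenvalue) simp_all
    have wf: "parcs \<Gamma> \<subseteq> pverts \<Gamma> \<times> pverts \<Gamma>" by (auto dest: G.wellformed')
    from iffD1[OF eigenvalue_adjacency_mat_iff[OF G.pair_finite_verts wf] ev] obtain f x where x: "x \<in> pverts \<Gamma>" "f x \<noteq> 0"
      and f: "\<forall>x\<in>pverts \<Gamma>. (\<Sum>y | (x, y) \<in> parcs \<Gamma>. f y) = smallest_eigenvalue \<Gamma> * f x"
      by blast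
    from f have "eigen (smallest_eigenvalue \<Gamma>) f" unfolding eigen_def .
    from cosine_sequence[OF this x] obtain u :: "nat \<Rightarrow> real" where u: "u 0 = 1"
      "\<And>i. i \<le> D \<Longrightarrow> (\<Sum>j\<le>D. p i j * u j) = smallest_eigenvalue \<Gamma> * u i"
      "\<And>f i x. eigen (smallest_eigenvalue \<Gamma>) f \<Longrightarrow> i \<le> D \<Longrightarrow> x \<in> pverts \<Gamma> \<Longrightarrow>
        sphere_sum i f x = sphere_size i * u i * f x"
      by blast
    interpret drg_cosines "pverts \<Gamma>" "\<lambda>x y. (x, y) \<in> parcs \<Gamma>" "graph_dist \<Gamma>" D b c
      "smallest_eigenvalue \<Gamma>" u
      by unfold_locales (fact assms(3) u)+
    have "b 0 \<le> K"
      unfolding K_def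
    proof (rule valency_le[OF assms(1,2) \<theta>])
      fix x y assume "x \<in> pverts \<Gamma>" "y \<in> pverts \<Gamma>"
      then have "(x, y) \<in> (parcs (graph_complement \<Gamma>))\<^sup>*"
        using co G.arcs_symmetric unfolding coconnected_def
        by (intro graph_connected_rtrancl) (auto simp: graph_complement_def)
      then show "(x, y) \<in> {(v, w). v \<in> pverts \<Gamma> \<and> w \<in> pverts \<Gamma> \<and> v \<noteq> w \<and> (v, w) \<notin> parcs \<Gamma>}\<^sup>*"
        by (simp add: graph_complement_def)
    next
      show "\<not> (\<exists>A B. A \<union> B = pverts \<Gamma> \<and> A \<inter> B = {} \<and>
        (\<forall>x y. (x, y) \<in> parcs \<Gamma> \<longrightarrow> x \<in> A \<and> y \<in> B \<or> x \<in> B \<and> y \<in> A))"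
      proof
        assume "\<exists>A B. A \<union> B = pverts \<Gamma> \<and> A \<inter> B = {} \<and>
          (\<forall>x y. (x, y) \<in> parcs \<Gamma> \<longrightarrow> x \<in> A \<and> y \<in> B \<or> x \<in> B \<and> y \<in> A)"
        then obtain A B where AB: "A \<union> B = pverts \<Gamma>" "A \<inter> B = {}"
          and arcs: "\<forall>x y. (x, y) \<in> parcs \<Gamma> \<longrightarrow> x \<in> A \<and> y \<in> B \<or> x \<in> B \<and> y \<in> A" by blast
        from arcs have "parcs \<Gamma> \<subseteq> A \<times> B \<union> B \<times> A" by auto
        then show False using nonbip AB unfolding bipartite_def by blast
      qed
    qed
    \<comment> \<open>At fixed diameter, the bound on the valency bounds the number of vertices
      uniformly.\<close>
    then have "(\<Sum>i\<le>D. b 0 ^ i) \<le> (\<Sum>i\<le>D. K ^ i)" by (intro sum_mono power_mono) simp_all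
    with card_V_le have "card (pverts \<Gamma>) \<le> (\<Sum>i\<le>D. K ^ i)" by (rule order_trans)
    then show ?thesis by (rule R[OF G])
  qed
  then show ?thesis using \<open>finite R\<close> by (intro exI[of _ R]) simp
qed

end
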